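(* Let $M\in\mathbb N$, $\mathcal A\subset\{0,\dots,M-1\}$ with $1<|\mathcal A|<M$, $\chi\in C_0^\infty((0,1);[0,1])$, and let $$\beta=-\limsup_{k\to\infty}\frac{\log r_k}{k\log M}.$$ Then for each $\nu\in(0,\beta)$ there exist constants $N_0,C$ depending on $\nu$ (and on $M,\mathcal A,\chi$) such that for all $N=M^k\ge N_0$, $k\in\mathbb N$, and all $\lambda\in\mathbb C$ with $M^{-\nu}\le|\lambda|\le1$, the operator $B_N-\lambda$ is invertible on $\ell^2_N$ and $$\|(B_N-\lambda)^{-1}\|_{\ell^2_N\to\ell^2_N}\le CN^{2\nu}.$$
   Context: $\mathbb Z_N=\mathbb Z/N\mathbb Z\simeq\{0,\dots,N-1\}$; $\ell^2_N$ is the space of functions $u:\mathbb Z_N\to\mathbb C$ with $\|u\|_{\ell^2_N}^2=\sum_{j=0}^{N-1}|u(j)|^2$. The unitary Fourier transform is $\mathcal F_Nu(j)=\frac1{\sqrt N}\sum_{\ell=0}^{N-1}\exp(-2\pi ij\ell/N)u(\ell)$. $\mathbf 1_X$ is multiplication by the indicator function of $X\subset\mathbb Z_N$. For $N=M^k$: $\mathcal C_k=\{\sum_{j=0}^{k-1}a_jM^j\mid a_0,\dots,a_{k-1}\in\mathcal A\}\subset\mathbb Z_N$ and $r_k=\|\mathbf 1_{\mathcal C_k}\mathcal F_N\mathbf 1_{\mathcal C_k}\|_{\ell^2_N\to\ell^2_N}$. For $\chi\in C_0^\infty((0,1);[0,1])$ (extended by zero), $\chi_N$ is the multiplication operator on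 $\ell^2_N$ by $\chi_N(j)=\chi(j/N)$, $j\in\{0,\dots,N-1\}$. Open quantum baker's map: for $N=M^k$ and $a\in\{0,\dots,M-1\}$, let $\Pi_a:\ell^2_N\to\ell^2_{N/M}$, $\Pi_au(j)=u(j+aN/M)$ for $j\in\{0,\dots,N/M-1\}$. Then $$B_N=B_{N,\chi}=\sum_{a\in\mathcal A}\mathcal F_N^*\,\Pi_a^*\,\chi_{N/M}\,\mathcal F_{N/M}\,\chi_{N/M}\,\Pi_a:\ell^2_N\to\ell^2_N.$$ *)

theory Defs
  imports "HOL-Analysis.Analysis" "Jordan_Normal_Form.Schur_Decomposition"
begin

unbundle no vec_syntax

text \<open>
  The space of functions \<open>\<int>\<^sub>N \<rightarrow> \<complex>\<close> is \<^term>\<open>carrier_vec N :: complex vec set\<close>, with the residues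
  modulo \<open>N\<close> represented by the indices \<open>0, \<dots>, N - 1\<close>. Linear operators between such spaces are
  complex matrices, composition is the matrix product and the Hilbert space adjoint is
  \<^const>\<open>mat_adjoint\<close>, the conjugate transpose.
\<close>

definition l2norm :: "complex vec \<Rightarrow> real" where
  "l2norm u = sqrt (\<Sum>j<dim_vec u. (cmod (u $ j))\<^sup>2)"

text \<open>
  Same formula as \<^const>\<open>onorm\<close>, relativised to the carrier; \<open>u = 0\<close> contributes \<open>0 / 0 = 0\<close>.
\<close>

definition opnorm :: "complex mat \<Rightarrow> real" where
  "opnorm T = (SUP u \<in> carrier_vec (dim_col T). l2norm (T *\<^sub>v u) / l2norm u)"

definition fourier :: "nat \<Rightarrow> complex mat" where
  "fourier N = Matrix.mat N N (\<lambda>(j, l).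
     exp (- 2 * of_real pi * \<i> * of_nat j * of_nat l / of_nat N) / of_real (sqrt (real N)))"

definition indicator_op :: "nat \<Rightarrow> nat set \<Rightarrow> complex mat" where
  "indicator_op N X = mat_diag N (indicator X)"

definition cantor :: "nat \<Rightarrow> nat set \<Rightarrow> nat \<Rightarrow> nat set" where
  "cantor M A k = {\<Sum>j<k. a j * M ^ j | a. \<forall>j<k. a j \<in> A}"

definition fup_norm :: "nat \<Rightarrow> nat set \<Rightarrow> nat \<Rightarrow> real" where
  "fup_norm M A k = (let N = M ^ k; X = cantor M A k in
     opnorm (indicator_op N X * fourier N * indicator_op N X))"

text \<open>
  The upper limit is taken in the extended reals, where it always exists.
\<close>

definition fup_exponent :: "nat \<Rightarrow> nat set \<Rightarrow> ereal" where
  "fup_exponent M A =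
     - limsup (\<lambda>k. ereal (ln (fup_norm M A k) / (real k * ln (real M))))"

text \<open>
  The elements of \<open>C\<^sub>0\<^sup>\<infinity>((0,1);[0,1])\<close> are regarded as functions on the whole real line, extended
  by zero. Boundedness of the support is implied, so closedness in \<open>(0,1)\<close> amounts to compactness.
\<close>

definition cutoffs :: "(real \<Rightarrow> real) set" where
  "cutoffs = {\<chi>. (\<forall>n x. (deriv ^^ n) \<chi> differentiable (at x)) \<and>
                  (\<forall>x. \<chi> x \<in> {0..1}) \<and>
                  closure {x. \<chi> x \<noteq> 0} \<subseteq> {0<..<1}}"

definition cutoff_op :: "(real \<Rightarrow> real) \<Rightarrow> nat \<Rightarrow> complex mat" where
  "cutoff_op \<chi> N = mat_diag N (\<lambda>j. of_real (\<chi> (real j / real N)))"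

text \<open>
  The matrix of the map sending \<open>u\<close> to \<open>j \<mapsto> u(j + a N / M)\<close>.
\<close>

definition proj_op :: "nat \<Rightarrow> nat \<Rightarrow> nat \<Rightarrow> complex mat" where
  "proj_op M N a = Matrix.mat (N div M) N (\<lambda>(j, l). if l = j + a * (N div M) then 1 else 0)"

text \<open>
  The sum over \<open>a \<in> A\<close> is written entrywise because matrices of unspecified dimension do not form
  an additive monoid type. Only meaningful when \<open>M\<close> divides \<open>N\<close>.
\<close>

definition baker_map :: "nat \<Rightarrow> nat set \<Rightarrow> (real \<Rightarrow> real) \<Rightarrow> nat \<Rightarrow> complex mat" where
  "baker_map M A \<chi> N = Matrix.mat N N (\<lambda>ij. \<Sum>a\<in>A.
     (mat_adjoint (fourier N) * mat_adjoint (proj_op M N a) *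
      cutoff_op \<chi> (N div M) * fourier (N div M) * cutoff_op \<chi> (N div M) * proj_op M N a) $$ ij)"

end

theory Submission
  imports Defs
begin

text \<open>
  Write \<open>N = M ^ k\<close>, \<open>F\<close> for the Fourier transform and \<open>B\<close> for the open baker's map. An approximate
  eigenvector of \<open>B\<close> with eigenvalue \<open>z\<close> would have to be concentrated near a Cantor set both in
  position and in frequency, which the uncertainty principle forbids when \<open>\<bar>z\<bar>\<close> is not too small.

  \<^emph>\<open>Classical dynamics.\<close> The map factors as \<open>B = F\<^sup>* D\<close>, where \<open>F\<close> is unitary and \<open>D\<close> is block diagonal with
  contractive blocks; so \<open>B\<close> is a contraction.
  Its matrix is an oscillatory sum with the smooth weight \<open>\<chi>\<close>, and repeated summation by parts
      shows that
  \<open>B\<close> moves mass from position \<open>y\<close> with leading digit \<open>a \<in> A\<close> to positions near \<open>M y - a N\<close>, with errors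
  that decay to any order (\<open>nonstationary_phase\<close>, \<open>baker_map_kernel_decay\<close>). Iterating \<open>m\<close> times, \<open>B\<^sup>m\<close> sees
  only positions whose \<open>m\<close> leading digits lie in \<open>A\<close>, up to a small thickening: with \<open>X\<close> the resulting
  neighbourhood of the Cantor set and \<open>Q\<close> the restriction to its complement, \<open>B\<^sup>m Q\<close> is negligible
  (\<open>baker_map_localized\<close>).

  \<^emph>\<open>Frequency.\<close> Both \<open>F\<close> and \<open>D\<close> are symmetric matrices, hence \<open>F B F\<^sup>* = B\<^sup>T\<close> (\<open>fourier_mult_baker_map\<close>).
  Consequently \<open>Q F B\<^sup>m\<close> is as small as \<open>B\<^sup>m Q\<close>: the vectors in the range of \<open>B\<^sup>m\<close> have their
  frequencies essentially in the same set \<open>X\<close>.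

  \<^emph>\<open>Uncertainty.\<close> Let \<open>P\<close> be the restriction to \<open>X\<close>. If \<open>m = k - s\<close>, then \<open>X\<close> is covered by \<open>O(M ^ s)\<close>
  translates of the Cantor set, so the norm \<open>\<kappa>\<close> of \<open>P F P\<close> is \<open>O(M ^ (2 * s))\<close> times the norm \<open>r\<^sub>k\<close> of the
  fractal uncertainty principle (\<open>op_bound_fourier_translates_both\<close>).

  \<^emph>\<open>Resolvent.\<close> Let \<open>v = B u - z u\<close>. As \<open>\<bar>z\<bar> \<le> 1\<close>, the vector \<open>B\<^sup>m u\<close> differs from \<open>z\<^sup>m u\<close>
      by at most \<open>m \<parallel>v\<parallel>\<close>.
  Localisation in frequency costs one factor \<open>\<bar>z\<bar>\<^sup>-\<^sup>m\<close> and localisation in position another one, which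
  leads in \<open>uncertainty_resolvent_bound\<close> to
  \<open>\<bar>z\<bar>\<^sup>2\<^sup>m \<parallel>u\<parallel> \<le> (\<bar>z\<bar>\<^sup>m \<kappa> + 2 \<epsilon>) \<parallel>u\<parallel> + 2 m \<parallel>v\<parallel>\<close>, where \<open>\<epsilon>\<close> bounds \<open>B\<^sup>m Q\<close>. Take \<open>s\<close> to be a small multiple
  \<open>\<sigma> k\<close> of \<open>k\<close>. Then \<open>\<kappa> = O(M powr ((2 * \<sigma> - \<beta>) * k))\<close> for some \<open>\<beta> > \<nu>\<close>, which is
  smaller than \<open>\<bar>z\<bar>\<^sup>m\<close> for large \<open>k\<close>, and a high enough order of decay makes \<open>\<epsilon>\<close> smaller than \<open>\<bar>z\<bar>\<^sup>2\<^sup>m\<close>. What remains is \<open>\<parallel>u\<parallel> \<le> 4 m \<bar>z\<bar>\<^sup>-\<^sup>2\<^sup>m \<parallel>v\<parallel>\<close>, and since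
  \<open>m\<close> is about \<open>(1 - \<sigma>) k\<close>, the factor \<open>m\<close> is absorbed into \<open>N powr (2 * \<nu>)\<close>.
\<close>

section \<open>Vectors, matrices and operator bounds\<close>

lemma l2norm_eq_L2_set: "l2norm u = L2_set (\<lambda>j. cmod (u $ j)) {..<dim_vec u}"
  by (simp add: l2norm_def L2_set_def)

lemma l2norm_nonneg [simp]: "0 \<le> l2norm u"
  by (simp add: l2norm_eq_L2_set)

lemma l2norm_power2: "(l2norm u)\<^sup>2 = (\<Sum>j<dim_vec u. (cmod (u $ j))\<^sup>2)"
  by (simp add: l2norm_def sum_nonneg)

lemma l2norm_add:
  assumes "dim_vec u = dim_vec v"
  shows "l2norm (u + v) \<le> l2norm u + l2norm v"
proof -
  have "l2norm (u + v) \<le> L2_set (\<lambda>j. cmod (u $ j) + cmod (v $ j)) {..<dim_vec v}"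
    unfolding l2norm_eq_L2_set using assms
    by (auto intro!: L2_set_mono norm_triangle_ineq)
  also have "\<dots> \<le> l2norm u + l2norm v"
    using L2_set_triangle_ineq assms unfolding l2norm_eq_L2_set by simp
  finally show ?thesis .
qed

lemma l2norm_smult: "l2norm (c \<cdot>\<^sub>v u) = cmod c * l2norm u"
  by (auto simp: l2norm_eq_L2_set norm_mult L2_set_right_distrib intro!: L2_set_cong)

lemma l2norm_zero_vec [simp]: "l2norm (0\<^sub>v n) = 0"
  by (simp add: l2norm_eq_L2_set L2_set_eq_0_iff)

lemma l2norm_eq_0_iff:
  assumes "u \<in> carrier_vec n"
  shows "l2norm u = 0 \<longleftrightarrow> u = 0\<^sub>v n"
proof
  show "u = 0\<^sub>v n" if "l2norm u = 0"
    using that assms by (intro eq_vecI) (auto simp: l2norm_eq_L2_set L2_set_eq_0_iff)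
qed simp

lemma l2norm_conjugate: "l2norm (conjugate u) = l2norm u"
  by (simp add: l2norm_eq_L2_set L2_set_def)

lemma l2norm_mono:
  assumes "dim_vec u = dim_vec v" "\<And>i. i < dim_vec v \<Longrightarrow> cmod (u $ i) \<le> cmod (v $ i)"
  shows "l2norm u \<le> l2norm v"
  using assms unfolding l2norm_eq_L2_set by (auto intro!: L2_set_mono)

lemma l2norm_le_sqrt_dim:
  assumes "\<And>i. i < dim_vec u \<Longrightarrow> cmod (u $ i) \<le> c" "0 \<le> c"
  shows "l2norm u \<le> sqrt (real (dim_vec u)) * c"
proof -
  have "l2norm u \<le> L2_set (\<lambda>_. c) {..<dim_vec u}"
    using assms unfolding l2norm_eq_L2_set by (auto intro!: L2_set_mono)
  then show ?thesis using assms by (simp add: L2_set_constant)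
qed

lemma Cauchy_Schwarz_vec:
  assumes "dim_vec u = dim_vec v"
  shows "cmod (u \<bullet> v) \<le> l2norm u * l2norm v"
proof -
  have "cmod (u \<bullet> v) \<le> (\<Sum>j<dim_vec v. \<bar>cmod (u $ j)\<bar> * \<bar>cmod (v $ j)\<bar>)"
    unfolding scalar_prod_def atLeast0LessThan
    by (rule order_trans[OF norm_sum]) (simp add: norm_mult)
  also have "\<dots> \<le> l2norm u * l2norm v"
    unfolding l2norm_eq_L2_set assms
    by (rule L2_set_mult_ineq)
  finally show ?thesis .
qed

lemma scalar_prod_conjugate_self:
  "u \<bullet> conjugate (u :: complex vec) = of_real ((l2norm u)\<^sup>2)"
  unfolding l2norm_power2 scalar_prod_def atLeast0LessThan
  by (auto simp: complex_norm_square simp del: of_real_power intro!: sum.cong)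

lemma mult_mat_index_sum:
  assumes "S \<in> carrier_mat n m" "T \<in> carrier_mat m l" "i < n" "j < l"
  shows "(S * T) $$ (i, j) = (\<Sum>k<m. S $$ (i, k) * T $$ (k, j))"
  using assms by (auto simp: scalar_prod_def atLeast0LessThan intro!: sum.cong)

lemma mult_mat_vec_index_sum:
  assumes "T \<in> carrier_mat n m" "u \<in> carrier_vec m" "i < n"
  shows "(T *\<^sub>v u) $ i = (\<Sum>j<m. T $$ (i, j) * u $ j)"
  using assms by (auto simp: scalar_prod_def atLeast0LessThan intro!: sum.cong)

text \<open>
  An upper bound on the operator norm in the form of an inequality for every vector, so that bounds
  compose without any appeal to suprema.
\<close>

definition op_bound :: "complex mat \<Rightarrow> real \<Rightarrow> bool" where
  "op_bound T c \<longleftrightarrow> (\<forall>u \<in> carrier_vec (dim_col T). l2norm (T *\<^sub>v u) \<le> c * l2norm u)"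

lemma op_boundD:
  "op_bound T c \<Longrightarrow> u \<in> carrier_vec (dim_col T) \<Longrightarrow> l2norm (T *\<^sub>v u) \<le> c * l2norm u"
  by (simp add: op_bound_def)

lemma op_bound_mult:
  assumes "op_bound S a" "op_bound T b" "0 \<le> a"
    and ST: "S \<in> carrier_mat n m" "T \<in> carrier_mat m l"
  shows "op_bound (S * T) (a * b)"
  unfolding op_bound_def
proof
  fix u :: "complex vec" assume "u \<in> carrier_vec (dim_col (S * T))"
  then have u: "u \<in> carrier_vec l" using ST by simp
  have "l2norm ((S * T) *\<^sub>v u) = l2norm (S *\<^sub>v (T *\<^sub>v u))"
    using assoc_mult_mat_vec[OF ST u] by simp
  also have "\<dots> \<le> a * l2norm (T *\<^sub>v u)"
    using ST by (intro op_boundD assms(1)) (auto intro!: carrier_vecI)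
  also have "\<dots> \<le> a * (b * l2norm u)"
    using assms(3) u ST by (intro mult_left_mono op_boundD assms(2)) auto
  finally show "l2norm ((S * T) *\<^sub>v u) \<le> a * b * l2norm u" by (simp add: mult.assoc)
qed

lemma op_bound_pow:
  assumes "T \<in> carrier_mat N N" "op_bound T 1"
  shows "op_bound (T ^\<^sub>m j) 1"
proof (induction j)
  case 0
  then show ?case using assms(1) by (auto simp: op_bound_def)
next
  case (Suc j)
  have "op_bound (T ^\<^sub>m j * T) (1 * 1)"
    by (rule op_bound_mult[OF Suc assms(2) _ pow_carrier_mat[OF assms(1)] assms(1)]) simp
  then show ?case by simp
qed

text \<open>
  A matrix and its transpose represent the same bilinear form, and the norm of \<open>T\<^sup>T u\<close> is tested by
  pairing it with its own conjugate.
\<close>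

lemma op_bound_transpose:
  assumes "op_bound T c" "0 \<le> c"
  shows "op_bound (transpose_mat T) c"
  unfolding op_bound_def
proof
  fix u :: "complex vec" assume "u \<in> carrier_vec (dim_col (transpose_mat T))"
  then have u: "u \<in> carrier_vec (dim_row T)" by simp
  define w where "w = transpose_mat T *\<^sub>v u"
  have w: "w \<in> carrier_vec (dim_col T)" unfolding w_def by (intro carrier_vecI) simp
  have "(l2norm w)\<^sup>2 = cmod (w \<bullet> conjugate w)"
    by (simp add: scalar_prod_conjugate_self norm_power)
  also have "w \<bullet> conjugate w = u \<bullet> (T *\<^sub>v conjugate w)"
    unfolding w_def[symmetric] using w u
    by (subst (1) w_def, intro transpose_vec_mult_scalar[of T "dim_row T" "dim_col T"])
      (auto intro!: carrier_vecI)
  also have "cmod \<dots> \<le> l2norm u * l2norm (T *\<^sub>v conjugate w)"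
    using u by (intro Cauchy_Schwarz_vec) auto
  also have "\<dots> \<le> l2norm u * (c * l2norm (conjugate w))"
    using assms w by (intro mult_left_mono op_boundD) auto
  finally have *: "l2norm w * l2norm w \<le> (c * l2norm u) * l2norm w"
    by (simp add: l2norm_conjugate power2_eq_square mult_ac)
  show "l2norm (transpose_mat T *\<^sub>v u) \<le> c * l2norm u"
  proof (cases "l2norm w = 0")
    case True
    then show ?thesis using \<open>0 \<le> c\<close> by (simp add: w_def)
  next
    case False
    then have "l2norm w > 0" using l2norm_nonneg[of w] by linarith
    then show ?thesis using * by (simp add: w_def)
  qed
qed

lemma op_bound_map_cnj:
  assumes "op_bound T c"
  shows "op_bound (map_mat cnj T) c"
  unfolding op_bound_def
proof
  fix u :: "complex vec" assume "u \<in> carrier_vec (dim_col (map_mat cnj T))"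
  then have u: "u \<in> carrier_vec (dim_col T)" by simp
  have "map_mat cnj T *\<^sub>v u = conjugate (T *\<^sub>v conjugate u)"
    using u by (intro eq_vecI) (auto simp: scalar_prod_def)
  then have "l2norm (map_mat cnj T *\<^sub>v u) = l2norm (T *\<^sub>v conjugate u)"
    by (simp add: l2norm_conjugate)
  also have "\<dots> \<le> c * l2norm (conjugate u)"
    using u by (intro op_boundD[OF assms]) auto
  finally show "l2norm (map_mat cnj T *\<^sub>v u) \<le> c * l2norm u"
    by (simp add: l2norm_conjugate)
qed

lemma op_bound_diag:
  assumes "\<And>i. i < N \<Longrightarrow> cmod (d i) \<le> 1"
  shows "op_bound (mat_diag N d) 1"
  unfolding op_bound_def
proof
  fix u :: "complex vec" assume "u \<in> carrier_vec (dim_col (mat_diag N d))"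
  then have u: "u \<in> carrier_vec N" by (simp add: mat_diag_def)
  then have eq: "(mat_diag N d *\<^sub>v u) $ i = d i * u $ i" if "i < N" for i
    using that by (auto simp: mat_diag_def scalar_prod_def atLeast0LessThan if_distrib if_distribR
        cong: if_cong)
  show "l2norm (mat_diag N d *\<^sub>v u) \<le> 1 * l2norm u"
    unfolding mult_1
  proof (rule l2norm_mono)
    show "dim_vec (mat_diag N d *\<^sub>v u) = dim_vec u" using u by (simp add: mat_diag_def)
    fix i assume "i < dim_vec u"
    then show "cmod ((mat_diag N d *\<^sub>v u) $ i) \<le> cmod (u $ i)"
      using u assms eq by (simp add: norm_mult mult_left_le_one_le)
  qed
qed

text \<open>
  This loses a factor of the order of the dimension. It serves for matrices whose entries are smaller
  than a prescribed negative power of the dimension.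
\<close>

lemma op_bound_entries:
  assumes "\<And>i j. i < dim_row T \<Longrightarrow> j < dim_col T \<Longrightarrow> cmod (T $$ (i, j)) \<le> e" "0 \<le> e"
  shows "op_bound T (sqrt (real (dim_row T)) * sqrt (real (dim_col T)) * e)"
  unfolding op_bound_def
proof
  fix u :: "complex vec" assume u: "u \<in> carrier_vec (dim_col T)"
  have "cmod ((T *\<^sub>v u) $ i) \<le> sqrt (real (dim_col T)) * e * l2norm u" if "i < dim_row T" for i
  proof -
    have "cmod ((T *\<^sub>v u) $ i) \<le> l2norm (row T i) * l2norm u"
      using that u by (auto intro!: Cauchy_Schwarz_vec)
    also have "l2norm (row T i) \<le> sqrt (real (dim_col T)) * e"
      using l2norm_le_sqrt_dim[of "row T i" e] that assms by simp
    finally show ?thesis by (simp add: mult_right_mono)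
  qed
  then show "l2norm (T *\<^sub>v u) \<le> sqrt (real (dim_row T)) * sqrt (real (dim_col T)) * e * l2norm u"
    using l2norm_le_sqrt_dim[of "T *\<^sub>v u" "sqrt (real (dim_col T)) * e * l2norm u"] assms(2)
    by (simp add: mult.assoc)
qed

lemma opnorm_le:
  assumes "op_bound T c" "0 \<le> c"
  shows "opnorm T \<le> c"
  unfolding opnorm_def
proof (rule cSUP_least)
  fix u :: "complex vec" assume "u \<in> carrier_vec (dim_col T)"
  then have "l2norm (T *\<^sub>v u) \<le> c * l2norm u" using assms by (simp add: op_boundD)
  then show "l2norm (T *\<^sub>v u) / l2norm u \<le> c"
    using assms(2) l2norm_nonneg[of u] by (cases "l2norm u = 0")  (auto simp: divide_le_eq less_le)
qed (use zero_carrier_vec in blast)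

text \<open>
  Since \<^const>\<open>opnorm\<close> is a supremum of reals, it says nothing before the set is known to be bounded.
\<close>

lemma bdd_above_opnorm:
  "bdd_above ((\<lambda>u. l2norm (T *\<^sub>v u) / l2norm u) ` carrier_vec (dim_col T))"
proof -
  let ?e = "\<Sum>i<dim_row T. \<Sum>j<dim_col T. cmod (T $$ (i, j))"
  have "0 \<le> ?e" by (simp add: sum_nonneg)
  have "cmod (T $$ (i, j)) \<le> ?e" if ij: "i < dim_row T" "j < dim_col T" for i j
  proof -
    have "cmod (T $$ (i, j)) \<le> (\<Sum>j<dim_col T. cmod (T $$ (i, j)))"
      using ij by (intro member_le_sum) auto
    also have "\<dots> \<le> ?e"
      using ij by (intro member_le_sum[of i _ "\<lambda>i. \<Sum>j<dim_col T. cmod (T $$ (i, j))"])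
        (auto simp: sum_nonneg)
    finally show ?thesis .
  qed
  from op_bound_entries[OF this \<open>0 \<le> ?e\<close>]
  obtain c where c: "op_bound T c" "0 \<le> c"
    by (smt (verit, best) \<open>0 \<le> ?e\<close> mult_nonneg_nonneg real_sqrt_ge_zero of_nat_0_le_iff)
  show ?thesis
  proof (rule bdd_aboveI2)
    fix u :: "complex vec" assume u: "u \<in> carrier_vec (dim_col T)"
    show "l2norm (T *\<^sub>v u) / l2norm u \<le> c"
      using op_boundD[OF c(1) u] c(2) l2norm_nonneg[of u]
      by (cases "l2norm u = 0")  (auto simp: divide_le_eq less_le)
  qed
qed

lemma opnorm_nonneg: "0 \<le> opnorm T"
proof -
  have "l2norm (T *\<^sub>v 0\<^sub>v (dim_col T)) / l2norm (0\<^sub>v (dim_col T)) \<le> opnorm T"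
    unfolding opnorm_def using bdd_above_opnorm by (intro cSUP_upper) auto
  then show ?thesis by simp
qed

lemma op_bound_opnorm: "op_bound T (opnorm T)"
  unfolding op_bound_def
proof
  fix u :: "complex vec" assume u: "u \<in> carrier_vec (dim_col T)"
  show "l2norm (T *\<^sub>v u) \<le> opnorm T * l2norm u"
  proof (cases "l2norm u = 0")
    case True
    then have "u = 0\<^sub>v (dim_col T)" using u by (simp add: l2norm_eq_0_iff)
    moreover have "T *\<^sub>v 0\<^sub>v (dim_col T) = 0\<^sub>v (dim_row T)" by (intro eq_vecI) auto
    ultimately show ?thesis by simp
  next
    case False
    then have "l2norm u > 0" using l2norm_nonneg[of u] by linarith
    moreover have "l2norm (T *\<^sub>v u) / l2norm u \<le> opnorm T"
      unfolding opnorm_def using u bdd_above_opnorm by (intro cSUP_upper) auto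
    ultimately show ?thesis by (simp add: field_simps)
  qed
qed

section \<open>Oscillatory sums with a smooth weight\<close>

text \<open>
  Multiplication of the sum by \<open>1 - w\<close> shifts the difference onto the weight \<open>f\<close>. The two boundary terms
  vanish when \<open>f\<close> is supported well inside the range of summation.
\<close>

lemma summation_by_parts:
  fixes f :: "real \<Rightarrow> real" and w :: complex
  shows "(1 - w) * (\<Sum>p<T. of_real (f (real p * h)) * w ^ p) =
    (\<Sum>p<T. of_real (f (real p * h) - f (real p * h - h)) * w ^ p)
      - of_real (f (real T * h - h)) * w ^ T + of_real (f (- h))"
  by (induction T) (simp_all add: algebra_simps)

text \<open>
  The discrete non-stationary phase estimate: \<open>L\<close> summations by parts against the phase \<open>w\<close> replace the
  weight by an \<open>L\<close>-th difference of step \<open>h\<close>, of size \<open>h ^ L\<close> by the mean value theorem. The functions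
  \<open>D i\<close> are the successive derivatives; carrying the whole sequence lets the induction pass to the
  difference \<open>D i x - D i (x - h)\<close>, which is again such a sequence.
\<close>

lemma oscillatory_sum_bound:
  fixes D :: "nat \<Rightarrow> real \<Rightarrow> real" and w :: complex
  assumes "\<And>i x. (D i has_real_derivative D (Suc i) x) (at x)"
    and "\<And>x. x \<le> 0 \<or> b \<le> x \<Longrightarrow> D 0 x = 0"
    and "\<And>x. \<bar>D L x\<bar> \<le> C"
    and "b + real L * h \<le> real T * h" and "0 < h" and "cmod w = 1"
  shows "cmod (1 - w) ^ L * cmod (\<Sum>p<T. of_real (D 0 (real p * h)) * w ^ p) \<le> real T * h ^ L * C"
  using assms
proof (induction L arbitrary: D b C)
  case 0
  have "cmod (\<Sum>p<T. of_real (D 0 (real p * h)) * w ^ p) \<le> (\<Sum>p<T. C)"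
    by (rule order_trans[OF norm_sum], rule sum_mono)
      (use 0 in \<open>simp add: norm_mult norm_power\<close>)
  then show ?case by simp
next
  case (Suc L)
  \<comment> \<open>One summation by parts replaces \<open>D\<close> by its backward difference, which is smaller by a factor
    \<open>h\<close> and supported in an interval longer by \<open>h\<close>.\<close>
  define D' where "D' i x = D i x - D i (x - h)" for i x
  have D': "cmod (1 - w) ^ L * cmod (\<Sum>p<T. of_real (D' 0 (real p * h)) * w ^ p)
      \<le> real T * h ^ L * (h * C)"
  proof (rule Suc.IH)
    fix i x
    have shift: "((\<lambda>x. D i (x - h)) has_real_derivative D (Suc i) (x - h) * 1) (at x)"
      by (rule DERIV_chain2[OF Suc.prems(1)]) (auto intro!: derivative_eq_intros)
    show "(D' i has_real_derivative D' (Suc i) x) (at x)"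
      using DERIV_diff[OF Suc.prems(1)[of i x] shift] by (simp add: D'_def[abs_def])
  next
    fix x assume "x \<le> 0 \<or> b + h \<le> x"
    then show "D' 0 x = 0"
      using Suc.prems(2)[of x] Suc.prems(2)[of "x - h"] \<open>0 < h\<close> by (auto simp: D'_def)
  next
    fix x
    obtain z where "D L x - D L (x - h) = (x - (x - h)) * D (Suc L) z"
      using MVT2[of "x - h" x "D L" "D (Suc L)"] Suc.prems(1) \<open>0 < h\<close> by auto
    then show "\<bar>D' L x\<bar> \<le> h * C"
      using Suc.prems(3)[of z] \<open>0 < h\<close> by (simp add: D'_def abs_mult)
  qed (use Suc.prems in \<open>simp_all add: algebra_simps\<close>)
  \<comment> \<open>so the boundary term at the upper end of the sum vanishes\<close>
  have "b \<le> real T * h - h"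
  proof -
    have "b + real L * h + h \<le> real T * h" using Suc.prems(4) by (simp add: algebra_simps)
    moreover have "0 \<le> real L * h" using \<open>0 < h\<close> by simp
    ultimately show ?thesis by linarith
  qed
  then have "(1 - w) * (\<Sum>p<T. of_real (D 0 (real p * h)) * w ^ p)
      = (\<Sum>p<T. of_real (D' 0 (real p * h)) * w ^ p)"
    using Suc.prems(2) \<open>0 < h\<close> unfolding summation_by_parts D'_def by simp
  then have "cmod (1 - w) * cmod (\<Sum>p<T. of_real (D 0 (real p * h)) * w ^ p)
      = cmod (\<Sum>p<T. of_real (D' 0 (real p * h)) * w ^ p)"
    by (metis norm_mult)
  then have "cmod (1 - w) ^ Suc L * cmod (\<Sum>p<T. of_real (D 0 (real p * h)) * w ^ p)
      = cmod (1 - w) ^ L * cmod (\<Sum>p<T. of_real (D' 0 (real p * h)) * w ^ p)"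
    by (simp only: power_Suc mult.assoc mult.left_commute[of "cmod (1 - w)"])
  then show ?case using D' by (simp only: power_Suc mult_ac)
qed

lemma cmod_1_minus_cis: "cmod (1 - cis t) = 2 * \<bar>sin (t / 2)\<bar>"
proof -
  have "(cmod (1 - cis t))\<^sup>2 = (1 - cos t)\<^sup>2 + (sin t)\<^sup>2"
    by (simp add: cmod_power2)
  also have "\<dots> = 2 - 2 * cos t"
    using sin_cos_squared_add[of t] by (simp add: power2_eq_square algebra_simps)
  also have "\<dots> = (2 * \<bar>sin (t / 2)\<bar>)\<^sup>2"
    using cos_double_sin[of "t / 2"] by (simp add: power_mult_distrib)
  finally show ?thesis by (rule power2_eq_imp_eq) auto
qed

lemma sin_ge_mult_cos:
  assumes "0 \<le> t" "t \<le> pi"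
  shows "t * cos t \<le> sin t"
proof (cases "t = 0")
  case False
  then obtain z where z: "0 < z" "z < t" "sin t - sin 0 = (t - 0) * cos z"
    using MVT2[of 0 t sin cos] assms by (auto intro: DERIV_sin)
  have "cos t \<le> cos z" using z assms by (intro cos_monotone_0_pi_le) auto
  then show ?thesis using z assms by (simp add: mult_left_mono)
qed simp

text \<open>
  The function \<open>1 - cis (2 * pi * \<theta>)\<close> has a simple zero at \<open>\<theta> = 0\<close>, and its next zeros \<open>1\<close> and \<open>-1\<close> are
  excluded.
\<close>

lemma cis_away_from_1:
  assumes "0 < \<delta>" "\<delta> \<le> 1"
  obtains c where "0 < c" "\<And>\<theta>. \<bar>\<theta>\<bar> \<le> 1 - \<delta> \<Longrightarrow> c * \<bar>\<theta>\<bar> \<le> cmod (1 - cis (2 * pi * \<theta>))"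
proof
  define \<kappa> where "\<kappa> = cos (pi * (1 - \<delta>) / 2)"
  have "0 < \<kappa>" unfolding \<kappa>_def using assms by (intro cos_gt_zero_pi) (auto simp: field_simps)
  then show "0 < 2 * pi * \<kappa>\<^sup>2" by simp
  fix \<theta> :: real assume \<theta>: "\<bar>\<theta>\<bar> \<le> 1 - \<delta>"
  \<comment> \<open>In terms of \<open>t\<close> the angle is \<open>4 * t\<close> up to sign, and \<open>cos t\<close> does not fall below \<open>\<kappa>\<close>.\<close>
  define t where "t = pi * \<bar>\<theta>\<bar> / 2"
  have t: "0 \<le> t" "t \<le> pi * (1 - \<delta>) / 2" "pi * (1 - \<delta>) / 2 \<le> pi / 2"
    unfolding t_def using \<theta> assms by (auto intro!: mult_left_mono divide_right_mono)
  have t_pi: "t \<le> pi" using t(2,3) pi_gt_zero by linarith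
  have cos: "\<kappa> \<le> cos t" unfolding \<kappa>_def using t pi_gt_zero by (intro cos_monotone_0_pi_le) linarith+
  have "t * \<kappa> \<le> t * cos t" using t cos by (intro mult_left_mono) auto
  also have "\<dots> \<le> sin t" using t t_pi by (intro sin_ge_mult_cos)
  finally have sin: "t * \<kappa> \<le> sin t" .
  have "t * \<kappa> * \<kappa> \<le> sin t * cos t"
    using sin cos \<open>0 < \<kappa>\<close> t by (intro mult_mono) (auto intro: order_trans[of _ "t * \<kappa>"])
  also have "2 * (sin t * cos t) = sin (2 * t)" by (simp add: sin_double)
  finally have "2 * t * \<kappa>\<^sup>2 \<le> sin (2 * t)" by (simp add: power2_eq_square)
  moreover have "\<bar>sin (pi * \<theta>)\<bar> = \<bar>sin (2 * t)\<bar>"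
    unfolding t_def by (cases "\<theta> \<ge> 0") auto
  ultimately have "2 * t * \<kappa>\<^sup>2 \<le> \<bar>sin (pi * \<theta>)\<bar>" by linarith
  then show "2 * pi * \<kappa>\<^sup>2 * \<bar>\<theta>\<bar> \<le> cmod (1 - cis (2 * pi * \<theta>))"
    unfolding cmod_1_minus_cis t_def by (simp add: algebra_simps)
qed

lemma cutoff_derivs:
  assumes "\<chi> \<in> cutoffs"
  shows "((deriv ^^ n) \<chi> has_real_derivative (deriv ^^ Suc n) \<chi> x) (at x)"
  using assms by (simp add: cutoffs_def DERIV_deriv_iff_real_differentiable)

lemma cutoff_support:
  assumes "\<chi> \<in> cutoffs"
  obtains \<delta> where "0 < \<delta>" "\<delta> \<le> 1" "\<And>x. \<chi> x \<noteq> 0 \<Longrightarrow> \<delta> \<le> x \<and> x \<le> 1 - \<delta>"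
proof -
  let ?S = "{x. \<chi> x \<noteq> 0}"
  have cl: "closure ?S \<subseteq> {0<..<1}" using assms by (simp add: cutoffs_def)
  then have "0 \<notin> closure ?S" "1 \<notin> closure ?S" by auto
  then obtain d e where d: "0 < d" "\<And>x. \<chi> x \<noteq> 0 \<Longrightarrow> d \<le> dist x 0"
    and e: "0 < e" "\<And>x. \<chi> x \<noteq> 0 \<Longrightarrow> e \<le> dist x 1"
    unfolding closure_approachable by (auto simp: not_less)
  have S: "0 < x \<and> x < 1" if "\<chi> x \<noteq> 0" for x
    using that cl closure_subset[of ?S] by auto
  show ?thesis
  proof
    show "0 < min 1 (min d e)" "min 1 (min d e) \<le> 1" using d e by auto
    show "min 1 (min d e) \<le> x \<and> x \<le> 1 - min 1 (min d e)" if "\<chi> x \<noteq> 0" for x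
      using d(2)[OF that] e(2)[OF that] S[OF that] by (auto simp: dist_real_def)
  qed
qed

text \<open>
  A derivative is continuous, hence bounded on the compact interval, and \<open>\<chi>\<close> is locally zero outside.
\<close>

lemma cutoff_deriv_bounded:
  assumes \<chi>: "\<chi> \<in> cutoffs"
  obtains C where "0 \<le> C" "\<And>x. \<bar>(deriv ^^ n) \<chi> x\<bar> \<le> C"
proof -
  have outside: "(deriv ^^ n) \<chi> x = 0" if "x \<notin> {0..1}" for n x
    using that
  proof (induction n arbitrary: x)
    case 0
    obtain \<delta> where "0 < \<delta>" "\<And>x. \<chi> x \<noteq> 0 \<Longrightarrow> \<delta> \<le> x \<and> x \<le> 1 - \<delta>"
      using cutoff_support[OF \<chi>] by blast
    then show ?case using 0 by fastforce
  next
    case (Suc n)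
    have "((\<lambda>_. 0) has_real_derivative (deriv ^^ Suc n) \<chi> x) (at x)"
      by (rule has_field_derivative_transform_within_open[OF cutoff_derivs[OF \<chi>], of "- {0..1}"])
        (use Suc in auto)
    then show ?case using DERIV_unique DERIV_const by blast
  qed
  have "continuous_on {0..1} ((deriv ^^ n) \<chi>)"
    by (intro continuous_at_imp_continuous_on ballI DERIV_continuous[OF cutoff_derivs[OF \<chi>]])
  then have "bounded ((deriv ^^ n) \<chi> ` {0..1})"
    by (intro compact_imp_bounded compact_continuous_image) auto
  then obtain C where C: "\<And>x. x \<in> {0..1} \<Longrightarrow> \<bar>(deriv ^^ n) \<chi> x\<bar> \<le> C"
    unfolding bounded_iff by (metis imageI real_norm_def)
  show ?thesis
  proof
    show "0 \<le> \<bar>C\<bar>" by simp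
    show "\<bar>(deriv ^^ n) \<chi> x\<bar> \<le> \<bar>C\<bar>" for x
      using C[of x] outside[of x n] by (cases "x \<in> {0..1}") (auto intro: order_trans)
  qed
qed

text \<open>
  The estimate \<open>oscillatory_sum_bound\<close> with step \<open>1 / n\<close>. The constant depends on \<open>\<chi>\<close>, \<open>\<delta>\<close> and the order
  \<open>L\<close>, but neither on \<open>n\<close> nor on the phase.
\<close>

lemma nonstationary_phase:
  assumes \<chi>: "\<chi> \<in> cutoffs" and \<delta>: "0 < \<delta>" "\<delta> \<le> 1"
  obtains K where "0 \<le> K"
    "\<And>n \<theta>. 1 \<le> n \<Longrightarrow> \<bar>\<theta>\<bar> \<le> 1 - \<delta> \<Longrightarrow>
      cmod (\<Sum>p<n. of_real (\<chi> (real p / real n)) * cis (2 * pi * \<theta>) ^ p) * (real n * \<bar>\<theta>\<bar>) ^ L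
        \<le> K * real n"
proof -
  obtain C where C: "0 \<le> C" "\<And>x. \<bar>(deriv ^^ L) \<chi> x\<bar> \<le> C" using cutoff_deriv_bounded[OF \<chi>, of L] by blast
  obtain c where c: "0 < c" "\<And>\<theta>. \<bar>\<theta>\<bar> \<le> 1 - \<delta> \<Longrightarrow> c * \<bar>\<theta>\<bar> \<le> cmod (1 - cis (2 * pi * \<theta>))"
    using cis_away_from_1[OF \<delta>] by blast
  obtain \<epsilon> where "0 < \<epsilon>" "\<And>x. \<chi> x \<noteq> 0 \<Longrightarrow> \<epsilon> \<le> x \<and> x \<le> 1 - \<epsilon>"
    using cutoff_support[OF \<chi>] by blast
  then have supp: "\<chi> x = 0" if "x \<le> 0 \<or> 1 \<le> x" for x
    using that by fastforce
  show ?thesis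
  proof
    show "0 \<le> (real L + 2) * C / c ^ L" using C c by simp
    fix n :: nat and \<theta> :: real assume n: "1 \<le> n" and \<theta>: "\<bar>\<theta>\<bar> \<le> 1 - \<delta>"
    define w where "w = cis (2 * pi * \<theta>)"
    \<comment> \<open>Each of the \<open>L\<close> differences lengthens the support by one grid step.\<close>
    define T where "T = n + L + 1"
    let ?S = "\<Sum>p<n. of_real (\<chi> (real p / real n)) * w ^ p"
    have "cmod (1 - w) ^ L * cmod (\<Sum>p<T. of_real ((deriv ^^ 0) \<chi> (real p * (1 / real n))) * w ^ p)
        \<le> real T * (1 / real n) ^ L * C"
      by (rule oscillatory_sum_bound[where D = "\<lambda>i. (deriv ^^ i) \<chi>" and b = 1])
        (use cutoff_derivs[OF \<chi>] supp C n in \<open>auto simp: T_def w_def field_simps\<close>)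
    also have "(\<Sum>p<T. of_real ((deriv ^^ 0) \<chi> (real p * (1 / real n))) * w ^ p) = ?S"
      using n by (intro sum.mono_neutral_cong_right) (auto simp: T_def supp)
    finally have 1: "cmod (1 - w) ^ L * cmod ?S \<le> real T * (1 / real n) ^ L * C" .
    have "real T \<le> (real L + 2) * real n"
    proof -
      have "(real L + 1) * 1 \<le> (real L + 1) * real n" using n by (intro mult_left_mono) auto
      then show ?thesis by (simp add: T_def algebra_simps)
    qed
    then have 2: "real T * (1 / real n) ^ L * C \<le> ((real L + 2) * real n) * (1 / real n) ^ L * C"
      using C by (intro mult_right_mono) auto
    have "(c * \<bar>\<theta>\<bar>) ^ L * cmod ?S \<le> cmod (1 - w) ^ L * cmod ?S"
      unfolding w_def using c \<theta> by (intro mult_right_mono power_mono) auto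
    with 1 2 have "(c * \<bar>\<theta>\<bar>) ^ L * cmod ?S \<le> ((real L + 2) * real n) * (1 / real n) ^ L * C"
      by linarith
    then have "(c * \<bar>\<theta>\<bar>) ^ L * cmod ?S * real n ^ L \<le> ((real L + 2) * real n) * C"
      using n by (simp add: power_divide field_simps)
    then show "cmod (\<Sum>p<n. of_real (\<chi> (real p / real n)) * cis (2 * pi * \<theta>) ^ p) * (real n * \<bar>\<theta>\<bar>) ^ L
        \<le> (real L + 2) * C / c ^ L * real n"
      using c unfolding w_def[symmetric] by (simp add: field_simps)
  qed
qed

section \<open>The discrete Fourier transform\<close>

lemma mat_adjoint_eq: "mat_adjoint (T :: complex mat) = map_mat cnj (transpose_mat T)"
  by (rule eq_matI) (auto simp: mat_adjoint_def mat_of_rows_index)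

lemma fourier_carrier [simp]: "fourier N \<in> carrier_mat N N"
  by (simp add: fourier_def)

lemma fourier_dim [simp]: "dim_row (fourier N) = N" "dim_col (fourier N) = N"
  by (simp_all add: fourier_def)

lemma fourier_index:
  assumes "j < N" "l < N"
  shows "fourier N $$ (j, l) = cis (- (2 * pi * real j * real l / real N)) / of_real (sqrt (real N))"
  using assms by (simp add: fourier_def cis_conv_exp mult_ac)

text \<open>
  The symmetry (as opposed to hermitian symmetry) of the Fourier matrix is what later makes
  frequency a mirror image of position.
\<close>

lemma fourier_symmetric: "transpose_mat (fourier N) = fourier N"
  by (rule eq_matI) (auto simp: fourier_def mult_ac)

lemma sum_roots_of_unity:
  assumes "0 < N" "\<not> int N dvd d"
  shows "(\<Sum>l<N. cis (2 * pi * of_int d / real N) ^ l) = 0"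
proof -
  let ?w = "cis (2 * pi * of_int d / real N)"
  have "?w \<noteq> 1"
  proof
    assume "?w = 1"
    then have "cos (2 * pi * of_int d / real N) = 1" by (simp add: complex_eq_iff)
    then obtain k :: int where "2 * pi * of_int d / real N = of_int k * 2 * pi"
      by (auto simp: cos_one_2pi_int)
    then have "real_of_int d = of_int (k * int N)"
      using assms(1) by (simp add: field_simps)
    then have "d = k * int N" by (simp only: of_int_eq_iff)
    then show False using assms(2) by simp
  qed
  moreover have "?w ^ N = 1"
  proof -
    have "?w ^ N = cis (real_of_int d * (2 * pi))"
      unfolding Complex.DeMoivre using assms(1) by (intro arg_cong[of _ _ cis]) simp
    also have "\<dots> = 1" by (metis cis_multiple_2pi Ints_of_int mult.commute)
    finally show ?thesis .
  qed
  ultimately show ?thesis by (simp add: geometric_sum)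
qed

lemma cnj_fourier_mult_fourier:
  assumes "0 < N"
  shows "map_mat cnj (fourier N) * fourier N = 1\<^sub>m N"
proof (rule eq_matI)
  fix i j assume ij: "i < dim_row (1\<^sub>m N :: complex mat)" "j < dim_col (1\<^sub>m N :: complex mat)"
  then have ij: "i < N" "j < N" by auto
  have "(map_mat cnj (fourier N) * fourier N) $$ (i, j)
      = (\<Sum>l<N. cnj (fourier N $$ (i, l)) * fourier N $$ (l, j))"
    using ij by (auto simp: scalar_prod_def atLeast0LessThan intro!: sum.cong)
  also have "\<dots> = (\<Sum>l<N. cis (2 * pi * of_int (int i - int j) / real N) ^ l / of_nat N)"
  proof (rule sum.cong)
    fix l assume "l \<in> {..<N}"
    then have l: "l < N" by simp
    have "cnj (fourier N $$ (i, l)) * fourier N $$ (l, j)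
        = (cis (2 * pi * real i * real l / real N) * cis (- (2 * pi * real l * real j / real N)))
          / (of_real (sqrt (real N)) * of_real (sqrt (real N)))"
      using ij l by (simp add: fourier_index cis_cnj)
    also have "of_real (sqrt (real N)) * of_real (sqrt (real N)) = (of_nat N :: complex)"
      by (simp flip: of_real_mult)
    also have "cis (2 * pi * real i * real l / real N) * cis (- (2 * pi * real l * real j / real N))
        = cis (2 * pi * of_int (int i - int j) / real N) ^ l"
      unfolding cis_mult Complex.DeMoivre
      by (rule arg_cong[of _ _ cis]) (use assms in \<open>simp add: field_simps\<close>)
    finally show "cnj (fourier N $$ (i, l)) * fourier N $$ (l, j)
        = cis (2 * pi * of_int (int i - int j) / real N) ^ l / of_nat N" .
  qed simp
  also have "\<dots> = (\<Sum>l<N. cis (2 * pi * of_int (int i - int j) / real N) ^ l) / of_nat N"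
    by (simp add: sum_divide_distrib)
  also have "\<dots> = 1\<^sub>m N $$ (i, j)"
  proof (cases "i = j")
    case False
    have "\<not> int N dvd int i - int j"
    proof
      assume "int N dvd int i - int j"
      then have "int i mod int N = int j mod int N" by (simp add: mod_eq_dvd_iff)
      then show False using ij False by simp
    qed
    then have "(\<Sum>l<N. cis (2 * pi * of_int (int i - int j) / real N) ^ l) = 0"
      by (rule sum_roots_of_unity[OF assms])
    then show ?thesis using ij False by simp
  qed (use ij assms in simp)
  finally show "(map_mat cnj (fourier N) * fourier N) $$ (i, j) = 1\<^sub>m N $$ (i, j)" .
qed auto

lemma fourier_mult_cnj_fourier:
  assumes "0 < N"
  shows "fourier N * map_mat cnj (fourier N) = 1\<^sub>m N"
  using mat_mult_left_right_inverse[OF _ _ cnj_fourier_mult_fourier[OF assms]] by simp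

lemma op_bound_fourier: "op_bound (fourier N) 1"
  unfolding op_bound_def
proof
  fix u :: "complex vec" assume "u \<in> carrier_vec (dim_col (fourier N))"
  then have u: "u \<in> carrier_vec N" by simp
  show "l2norm (fourier N *\<^sub>v u) \<le> 1 * l2norm u"
  proof (cases "N = 0")
    case True
    then show ?thesis using u by (simp add: l2norm_def)
  next
    case False
    have conj: "conjugate (fourier N *\<^sub>v u) = map_mat cnj (fourier N) *\<^sub>v conjugate u"
      using u by (intro eq_vecI) (auto simp: scalar_prod_def)
    have w: "map_mat cnj (fourier N) *\<^sub>v conjugate u \<in> carrier_vec N"
      using u by (intro mult_mat_vec_carrier[of _ N N]) auto
    have "complex_of_real ((l2norm (fourier N *\<^sub>v u))\<^sup>2)
        = (fourier N *\<^sub>v u) \<bullet> (map_mat cnj (fourier N) *\<^sub>v conjugate u)"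
      by (simp only: scalar_prod_conjugate_self[symmetric] conj)
    also have "\<dots> = u \<bullet> (fourier N *\<^sub>v (map_mat cnj (fourier N) *\<^sub>v conjugate u))"
      using transpose_vec_mult_scalar[OF fourier_carrier w u] unfolding fourier_symmetric .
    also have "fourier N *\<^sub>v (map_mat cnj (fourier N) *\<^sub>v conjugate u)
        = (fourier N * map_mat cnj (fourier N)) *\<^sub>v conjugate u"
      using u by (intro assoc_mult_mat_vec[symmetric, of _ N N _ N]) auto
    also have "\<dots> = conjugate u"
      using u False by (simp add: fourier_mult_cnj_fourier)
    finally have "(l2norm (fourier N *\<^sub>v u))\<^sup>2 = (l2norm u)\<^sup>2"
      unfolding scalar_prod_conjugate_self of_real_eq_iff .
    then show ?thesis by (simp add: power2_eq_iff_nonneg)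
  qed
qed

section \<open>Factorisation and symmetry of the baker's map\<close>

text \<open>
  An index below \<open>m * n\<close> is a pair of a leading digit \<open>a\<close> and a remainder \<open>p\<close>.
\<close>

lemma sum_blocks:
  fixes f :: "nat \<Rightarrow> 'a :: comm_monoid_add"
  shows "(\<Sum>i<m * n. f i) = (\<Sum>a<m. \<Sum>p<n. f (a * n + p))"
proof -
  have block: "sum f {a * n..<a * n + n} = (\<Sum>p<n. f (a * n + p))" for a
    by (simp add: sum.atLeastLessThan_shift_0[of f "a * n"] atLeast0LessThan)
  show ?thesis by (simp flip: block) (rule sum.nat_group[symmetric])
qed

lemma block_index_less:
  assumes "a < m" "p < (n::nat)"
  shows "a * n + p < m * n"
proof -
  have "a * n + p < (a + 1) * n" using assms by simp
  also have "\<dots> \<le> m * n" using assms by (intro mult_le_mono1) simp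
  finally show ?thesis .
qed

definition baker_block :: "(real \<Rightarrow> real) \<Rightarrow> nat \<Rightarrow> complex mat" where
  "baker_block \<chi> n = cutoff_op \<chi> n * fourier n * cutoff_op \<chi> n"

text \<open>
  The baker's map without the outer inverse Fourier transform: block diagonal with respect to the
  leading digit, which is the quotient of the index by \<open>n\<close>, with one copy of the block for each digit
  in \<open>A\<close>.
\<close>

definition baker_diag :: "nat \<Rightarrow> nat set \<Rightarrow> (real \<Rightarrow> real) \<Rightarrow> nat \<Rightarrow> complex mat" where
  "baker_diag M A \<chi> n = Matrix.mat (M * n) (M * n) (\<lambda>(i, j).
     if i div n = j div n \<and> i div n \<in> A then baker_block \<chi> n $$ (i mod n, j mod n) else 0)"

lemma cutoff_op_carrier [simp]: "cutoff_op \<chi> n \<in> carrier_mat n n"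
  by (simp add: cutoff_op_def)

lemma cutoff_op_dim [simp]: "dim_row (cutoff_op \<chi> n) = n" "dim_col (cutoff_op \<chi> n) = n"
  using cutoff_op_carrier by blast+

lemma baker_block_carrier [simp]: "baker_block \<chi> n \<in> carrier_mat n n"
  by (auto simp: baker_block_def)

lemma baker_diag_carrier [simp]: "baker_diag M A \<chi> n \<in> carrier_mat (M * n) (M * n)"
  by (simp add: baker_diag_def)

lemma baker_block_index:
  assumes "p < n" "q < n"
  shows "baker_block \<chi> n $$ (p, q) =
    of_real (\<chi> (real p / real n)) * fourier n $$ (p, q) * of_real (\<chi> (real q / real n))"
  using assms unfolding baker_block_def cutoff_op_def
  by (subst mat_diag_mult_left[of _ n n], simp, subst mat_diag_mult_right[of _ n n]) auto

lemma baker_block_symmetric: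
  assumes "p < n" "q < n"
  shows "baker_block \<chi> n $$ (p, q) = baker_block \<chi> n $$ (q, p)"
proof -
  have "transpose_mat (fourier n) $$ (p, q) = fourier n $$ (q, p)"
    using assms by simp
  then show ?thesis using assms by (simp add: baker_block_index fourier_symmetric)
qed

text \<open>
  The matrices \<open>\<Pi>\<^sub>a\<close> cut out the blocks, so \<open>\<Pi>\<^sub>a\<^sup>* K \<Pi>\<^sub>a\<close> puts \<open>K\<close> into the block of the leading digit
  \<open>a\<close> and zeros elsewhere.
\<close>

lemma baker_map_eq:
  assumes "0 < n" "A \<subseteq> {..<M}"
  shows "baker_map M A \<chi> (M * n) = map_mat cnj (fourier (M * n)) * baker_diag M A \<chi> n"
proof (rule eq_matI)
  let ?N = "M * n" and ?K = "baker_block \<chi> n"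
  let ?P = "proj_op M ?N"
  fix i j assume "i < dim_row (map_mat cnj (fourier ?N) * baker_diag M A \<chi> n)"
    "j < dim_col (map_mat cnj (fourier ?N) * baker_diag M A \<chi> n)"
  then have ij: "i < ?N" "j < ?N" by (auto simp: baker_diag_def)
  then have M: "0 < M" by (cases M) auto
  then have div: "?N div M = n" by simp
  have P: "?P a \<in> carrier_mat n ?N" for a by (simp add: proj_op_def div)
  have pos: "l = p + a * n \<longleftrightarrow> l div n = a \<and> l mod n = p" if "p < n" for l p a
  proof
    show "l div n = a \<and> l mod n = p" if "l = p + a * n" using that \<open>p < n\<close> by simp
    show "l = p + a * n" if "l div n = a \<and> l mod n = p"
      using that div_mult_mod_eq[of l n] by simp
  qed
  have Pidx: "?P a $$ (p, l) = (if l div n = a \<and> l mod n = p then 1 else 0)"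
    if "p < n" "l < ?N" for a p l
    using that by (simp add: proj_op_def div pos)
  have KP: "(?K * ?P a) $$ (p, l) = (if l div n = a then ?K $$ (p, l mod n) else 0)"
    if "p < n" "l < ?N" for a p l
  proof -
    have "(?K * ?P a) $$ (p, l) = (\<Sum>q<n. ?K $$ (p, q) * (if l div n = a \<and> l mod n = q then 1 else 0))"
      using that P[of a]
      by (subst mult_mat_index_sum[of _ n n _ ?N]) (auto simp: Pidx intro!: sum.cong)
    also have "\<dots> = (if l div n = a then ?K $$ (p, l mod n) else 0)"
      using assms(1) by (simp add: if_distrib cong: if_cong)
    finally show ?thesis .
  qed
  have PKP: "(mat_adjoint (?P a) * (?K * ?P a)) $$ (l, j)
      = (if l div n = a \<and> j div n = a then ?K $$ (l mod n, j mod n) else 0)" if l: "l < ?N" for a l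
  proof -
    have "(mat_adjoint (?P a) * (?K * ?P a)) $$ (l, j)
        = (\<Sum>p<n. (if l div n = a \<and> l mod n = p then 1 else 0) * (?K * ?P a) $$ (p, j))"
      using l ij P[of a] mult_carrier_mat[OF baker_block_carrier P, of \<chi> a]
      by (subst mult_mat_index_sum[of _ ?N n _ ?N])
        (auto simp: mat_adjoint_eq Pidx simp del: index_mult_mat(1) intro!: sum.cong)
    also have "\<dots> = (if l div n = a then (?K * ?P a) $$ (l mod n, j) else 0)"
      using assms(1) by (simp add: if_distribR if_distrib cong: if_cong)
    also have "\<dots> = (if l div n = a \<and> j div n = a then ?K $$ (l mod n, j mod n) else 0)"
      using assms(1) ij by (simp add: KP)
    finally show ?thesis .
  qed
  have finA: "finite A" using assms(2) finite_subset by blast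
  have "baker_map M A \<chi> ?N $$ (i, j) = (\<Sum>a\<in>A.
     (mat_adjoint (fourier ?N) * mat_adjoint (?P a) * cutoff_op \<chi> n * fourier n * cutoff_op \<chi> n * ?P a) $$ (i, j))"
    using ij by (simp add: baker_map_def div)
  also have "\<dots> = (\<Sum>a\<in>A. (map_mat cnj (fourier ?N) * (mat_adjoint (?P a) * (?K * ?P a))) $$ (i, j))"
  proof (rule sum.cong)
    fix a
    have Pa: "mat_adjoint (?P a) \<in> carrier_mat ?N n" using P by (simp add: mat_adjoint_eq)
    let ?Y = "mat_adjoint (fourier ?N) * mat_adjoint (?P a)"
    have F: "mat_adjoint (fourier ?N) = map_mat cnj (fourier ?N)"
      by (simp add: mat_adjoint_eq fourier_symmetric)
    have Fc: "mat_adjoint (fourier ?N) \<in> carrier_mat ?N ?N"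
      unfolding F by simp
    have Y: "?Y \<in> carrier_mat ?N n" by (rule mult_carrier_mat[OF Fc Pa])
    have c: "cutoff_op \<chi> n * fourier n \<in> carrier_mat n n"
      by (rule mult_carrier_mat[OF cutoff_op_carrier fourier_carrier])
    have "?Y * cutoff_op \<chi> n * fourier n * cutoff_op \<chi> n = ?Y * ?K"
      unfolding baker_block_def assoc_mult_mat[OF Y cutoff_op_carrier fourier_carrier]
      by (rule assoc_mult_mat[OF Y c cutoff_op_carrier])
    then have "?Y * cutoff_op \<chi> n * fourier n * cutoff_op \<chi> n * ?P a = ?Y * (?K * ?P a)"
      by (simp only: assoc_mult_mat[OF Y baker_block_carrier P])
    also have "\<dots> = map_mat cnj (fourier ?N) * (mat_adjoint (?P a) * (?K * ?P a))"
      using assoc_mult_mat[OF Fc Pa mult_carrier_mat[OF baker_block_carrier P]] unfolding F .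
    finally have "mat_adjoint (fourier ?N) * mat_adjoint (?P a) * cutoff_op \<chi> n * fourier n
        * cutoff_op \<chi> n * ?P a
      = map_mat cnj (fourier ?N) * (mat_adjoint (?P a) * (?K * ?P a))" .
    then show "(mat_adjoint (fourier ?N) * mat_adjoint (?P a) * cutoff_op \<chi> n * fourier n
        * cutoff_op \<chi> n * ?P a) $$ (i, j)
      = (map_mat cnj (fourier ?N) * (mat_adjoint (?P a) * (?K * ?P a))) $$ (i, j)" by simp
  qed simp
  also have "\<dots> = (\<Sum>a\<in>A. \<Sum>l<?N. cnj (fourier ?N $$ (i, l)) * (mat_adjoint (?P a) * (?K
      * ?P a)) $$ (l, j))"
  proof (rule sum.cong)
    fix a
    have "mat_adjoint (?P a) * (?K * ?P a) \<in> carrier_mat ?N ?N"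
      using P[of a] by (auto simp: mat_adjoint_eq intro!: carrier_matI)
    then show "(map_mat cnj (fourier ?N) * (mat_adjoint (?P a) * (?K * ?P a))) $$ (i, j)
      = (\<Sum>l<?N. cnj (fourier ?N $$ (i, l)) * (mat_adjoint (?P a) * (?K * ?P a)) $$ (l, j))"
      using ij by (subst mult_mat_index_sum[of _ ?N ?N _ ?N])
        (auto simp del: index_mult_mat(1) intro!: sum.cong)
  qed simp
  also have "\<dots> = (\<Sum>l<?N. cnj (fourier ?N $$ (i, l)) * (\<Sum>a\<in>A. (mat_adjoint (?P a) * (?K
      * ?P a)) $$ (l, j)))"
    by (subst sum.swap) (simp add: sum_distrib_left)
  also have "\<dots> = (\<Sum>l<?N. cnj (fourier ?N $$ (i, l)) * baker_diag M A \<chi> n $$ (l, j))"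
  proof (rule sum.cong)
    fix l assume "l \<in> {..<?N}"
    then have l: "l < ?N" by simp
    have "(\<Sum>a\<in>A. (mat_adjoint (?P a) * (?K * ?P a)) $$ (l, j))
        = (\<Sum>a\<in>A.
            if a = l div n then (if j div n = l div n then ?K $$ (l mod n, j mod n) else 0) else 0)"
      using l by (intro sum.cong) (auto simp: PKP simp del: index_mult_mat(1))
    also have "\<dots> = baker_diag M A \<chi> n $$ (l, j)"
      using finA l ij by (auto simp: baker_diag_def)
    finally show "cnj (fourier ?N $$ (i, l)) * (\<Sum>a\<in>A. (mat_adjoint (?P a) * (?K * ?P a)) $$ (l, j))
      = cnj (fourier ?N $$ (i, l)) * baker_diag M A \<chi> n $$ (l, j)" by simp
  qed simp
  also have "\<dots> = (map_mat cnj (fourier ?N) * baker_diag M A \<chi> n) $$ (i, j)"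
    using ij by (subst mult_mat_index_sum[of _ ?N ?N _ ?N]) (auto intro!: sum.cong)
  finally show "baker_map M A \<chi> ?N $$ (i, j)
      = (map_mat cnj (fourier ?N) * baker_diag M A \<chi> n) $$ (i, j)" .
qed (auto simp: baker_map_def baker_diag_def)

lemma op_bound_cutoff:
  assumes "\<chi> \<in> cutoffs"
  shows "op_bound (cutoff_op \<chi> n) 1"
  unfolding cutoff_op_def using assms by (intro op_bound_diag) (simp add: cutoffs_def)

lemma op_bound_baker_block:
  assumes "\<chi> \<in> cutoffs"
  shows "op_bound (baker_block \<chi> n) 1"
proof -
  have "op_bound (cutoff_op \<chi> n * fourier n) (1 * 1)"
    by (rule op_bound_mult[OF op_bound_cutoff[OF assms] op_bound_fourier _ cutoff_op_carrier fourier_carrier]) simp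
  then have "op_bound (cutoff_op \<chi> n * fourier n * cutoff_op \<chi> n) (1 * 1 * 1)"
    by (rule op_bound_mult[OF _ op_bound_cutoff[OF assms] _
          mult_carrier_mat[OF cutoff_op_carrier fourier_carrier] cutoff_op_carrier]) simp
  then show ?thesis by (simp add: baker_block_def)
qed

lemma baker_diag_index:
  assumes "a < M" "b < M" "p < n" "q < n"
  shows "baker_diag M A \<chi> n $$ (a * n + p, b * n + q)
    = (if a = b \<and> a \<in> A then baker_block \<chi> n $$ (p, q) else 0)"
  using assms block_index_less[of a M p n] block_index_less[of b M q n]
  by (auto simp: baker_diag_def)

lemma baker_diag_symmetric: "transpose_mat (baker_diag M A \<chi> n) = baker_diag M A \<chi> n"
proof (rule eq_matI)
  fix i j assume "i < dim_row (baker_diag M A \<chi> n)" "j < dim_col (baker_diag M A \<chi> n)"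
  then have ij: "i < M * n" "j < M * n" by (auto simp: baker_diag_def)
  then have "0 < n" by (cases n) auto
  then have "baker_block \<chi> n $$ (j mod n, i mod n) = baker_block \<chi> n $$ (i mod n, j mod n)"
    by (intro baker_block_symmetric) auto
  then show "transpose_mat (baker_diag M A \<chi> n) $$ (i, j) = baker_diag M A \<chi> n $$ (i, j)"
    using ij by (auto simp: baker_diag_def)
qed (auto simp: baker_diag_def)

text \<open>
  The blocks act on orthogonal subspaces, and each is a product of contractions.
\<close>

lemma op_bound_baker_diag:
  assumes "\<chi> \<in> cutoffs"
  shows "op_bound (baker_diag M A \<chi> n) 1"
  unfolding op_bound_def
proof
  let ?D = "baker_diag M A \<chi> n"
  fix u :: "complex vec" assume "u \<in> carrier_vec (dim_col ?D)"
  then have u: "u \<in> carrier_vec (M * n)" by (simp add: baker_diag_def)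
  define blk where "blk a = vec n (\<lambda>q. u $ (a * n + q))" for a
  have entry: "(?D *\<^sub>v u) $ (a * n + p) = (if a \<in> A then (baker_block \<chi> n *\<^sub>v blk a) $ p else 0)"
    if ap: "a < M" "p < n" for a p
  proof -
    have "(?D *\<^sub>v u) $ (a * n + p) = (\<Sum>j<M * n. ?D $$ (a * n + p, j) * u $ j)"
      using u block_index_less[OF ap] by (intro mult_mat_vec_index_sum) auto
    also have "\<dots> = (\<Sum>b<M. \<Sum>q<n. ?D $$ (a * n + p, b * n + q) * u $ (b * n + q))"
      by (rule sum_blocks)
    also have "\<dots> = (\<Sum>b<M. if b
        = a then (\<Sum>q<n. (if a \<in> A then baker_block \<chi> n $$ (p, q) * u $ (a * n + q) else 0)) else 0)"
    proof (rule sum.cong)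
      fix b assume "b \<in> {..<M}"
      then show "(\<Sum>q<n. ?D $$ (a * n + p, b * n + q) * u $ (b * n + q))
        = (if b = a then (\<Sum>q<n. (if a \<in> A then baker_block \<chi> n $$ (p, q) * u $ (a * n + q) else 0)) else 0)"
        using ap by (cases "b = a"; cases "a \<in> A") (simp_all add: baker_diag_index)
    qed simp
    also have "\<dots> = (if a \<in> A then (\<Sum>q<n. baker_block \<chi> n $$ (p, q) * blk a $ q) else 0)"
      using ap by (simp add: blk_def)
    also have "\<dots> = (if a \<in> A then (baker_block \<chi> n *\<^sub>v blk a) $ p else 0)"
      using ap by (subst mult_mat_vec_index_sum[of _ n n]) (auto simp: blk_def)
    finally show ?thesis .
  qed
  have block: "(\<Sum>p<n. (cmod ((?D *\<^sub>v u) $ (a * n + p)))\<^sup>2) \<le> (l2norm (blk a))\<^sup>2" if a: "a < M" for a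
  proof (cases "a \<in> A")
    case True
    have "(\<Sum>p<n. (cmod ((?D *\<^sub>v u) $ (a * n + p)))\<^sup>2) = (l2norm (baker_block \<chi> n *\<^sub>v blk a))\<^sup>2"
      using a True carrier_matD[OF baker_block_carrier, of \<chi> n] by (simp add: l2norm_power2 entry)
    also have "\<dots> \<le> (1 * l2norm (blk a))\<^sup>2"
      using carrier_matD[OF baker_block_carrier, of \<chi> n]
      by (intro power_mono op_boundD op_bound_baker_block assms) (auto simp: blk_def)
    finally show ?thesis by simp
  qed (use a in \<open>simp add: entry\<close>)
  have "(l2norm (?D *\<^sub>v u))\<^sup>2 = (\<Sum>a<M. \<Sum>p<n. (cmod ((?D *\<^sub>v u) $ (a * n + p)))\<^sup>2)"
    using carrier_matD[OF baker_diag_carrier, of M A \<chi> n]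
        by (simp add: l2norm_power2 sum_blocks del: index_mult_mat_vec)
  also have "\<dots> \<le> (\<Sum>a<M. (l2norm (blk a))\<^sup>2)"
    using block by (intro sum_mono) auto
  also have "\<dots> = (l2norm u)\<^sup>2"
    using u by (simp add: l2norm_power2 sum_blocks blk_def)
  finally show "l2norm (?D *\<^sub>v u) \<le> 1 * l2norm u"
    by (simp add: power2_le_imp_le[of "l2norm (?D *\<^sub>v u)" "l2norm u"])
qed

lemma baker_map_carrier [simp]: "baker_map M A \<chi> N \<in> carrier_mat N N"
  by (simp add: baker_map_def)

lemma op_bound_baker_map:
  assumes "\<chi> \<in> cutoffs" "0 < n" "A \<subseteq> {..<M}"
  shows "op_bound (baker_map M A \<chi> (M * n)) 1"
proof -
  have "op_bound (map_mat cnj (fourier (M * n)) * baker_diag M A \<chi> n) (1 * 1)"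
    by (intro op_bound_mult[of _ _ _ _ "M * n" "M * n" "M * n"] op_bound_map_cnj
        op_bound_fourier op_bound_baker_diag assms(1)) simp_all
  then show ?thesis using assms by (simp add: baker_map_eq)
qed

text \<open>
  With \<open>B = F\<^sup>* D\<close>, where \<open>F\<close> and \<open>D\<close> are symmetric and \<open>F\<close> is unitary, both sides equal \<open>D\<close>. Conjugation by the
  Fourier transform therefore transposes the baker's map, which exchanges the roles of position and
  frequency.
\<close>

lemma fourier_mult_baker_map:
  assumes "0 < n" "A \<subseteq> {..<M}"
  shows "fourier (M * n) * baker_map M A \<chi> (M * n)
    = transpose_mat (baker_map M A \<chi> (M * n)) * fourier (M * n)"
proof (cases "M = 0")
  case True
  then show ?thesis by (intro eq_matI) (auto simp: baker_map_def)
next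
  case False
  let ?F = "fourier (M * n)" and ?G = "map_mat cnj (fourier (M * n))" and ?D = "baker_diag M A \<chi> n"
  have N: "0 < M * n" using False assms by simp
  have G: "?G \<in> carrier_mat (M * n) (M * n)" by simp
  have "transpose_mat ?G = ?G"
  proof -
    have "transpose_mat ?G = map_mat cnj (transpose_mat ?F)" by (rule eq_matI) auto
    then show ?thesis by (simp add: fourier_symmetric)
  qed
  then have "transpose_mat (?G * ?D) = ?D * ?G"
    by (simp add: transpose_mult[OF G baker_diag_carrier] baker_diag_symmetric)
  then have "transpose_mat (?G * ?D) * ?F = ?D * (?G * ?F)"
    by (simp add: assoc_mult_mat[OF baker_diag_carrier G fourier_carrier])
  also have "\<dots> = ?D"
    by (simp add: cnj_fourier_mult_fourier[OF N] right_mult_one_mat[OF baker_diag_carrier])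
  also have "\<dots> = ?F * (?G * ?D)"
    by (simp add: assoc_mult_mat[OF fourier_carrier G baker_diag_carrier, symmetric] fourier_mult_cnj_fourier[OF N]
        left_mult_one_mat[OF baker_diag_carrier])
  finally show ?thesis using assms by (simp add: baker_map_eq)
qed

section \<open>Concentration of the kernel on the graph of the expanding map\<close>

text \<open>
  Summation over the intermediate frequency \<open>a * n + p\<close> leaves an oscillatory sum over \<open>p\<close> whose phase
  is stationary at \<open>x = M * q\<close>, the image of \<open>a * n + q\<close> under the expanding map \<open>y \<mapsto> M y mod N\<close>.
\<close>

lemma baker_map_index:
  assumes "0 < n" "A \<subseteq> {..<M}" "x < M * n" "a < M" "q < n"
  shows "cmod (baker_map M A \<chi> (M * n) $$ (x, a * n + q)) =
    (if a \<in> A then \<bar>\<chi> (real q / real n)\<bar> / (sqrt (real (M * n)) * sqrt (real n)) *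
      cmod (\<Sum>p<n. of_real (\<chi> (real p / real n)) *
        cis (2 * pi * (real x / real (M * n) - real q / real n)) ^ p) else 0)"
proof -
  let ?\<theta> = "real x / real (M * n) - real q / real n"
  let ?c = "of_real (\<chi> (real q / real n)) * cis (2 * pi * real a * real x / real M) /
        (of_real (sqrt (real (M * n))) * of_real (sqrt (real n))) :: complex"
  have M: "0 < M" using assms by auto
  have "baker_map M A \<chi> (M * n) $$ (x, a * n + q)
      = (\<Sum>l<M * n. map_mat cnj (fourier (M * n)) $$ (x, l) * baker_diag M A \<chi> n $$ (l, a * n + q))"
    using assms block_index_less[OF assms(4,5)] unfolding baker_map_eq[OF assms(1,2)]
    by (intro mult_mat_index_sum[of _ "M * n" "M * n" _ "M * n"]) auto
  also have "\<dots> = (\<Sum>b<M. \<Sum>p<n. map_mat cnj (fourier (M * n)) $$ (x, b * n + p) *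
      baker_diag M A \<chi> n $$ (b * n + p, a * n + q))"
    by (rule sum_blocks)
  also have "\<dots> = (\<Sum>b<M. if b = a then (if a \<in> A then
      (\<Sum>p<n. map_mat cnj (fourier (M * n)) $$ (x, a * n + p) * baker_block \<chi> n $$ (p, q)) else 0) else 0)"
    using assms by (intro sum.cong) (auto simp: baker_diag_index)
  also have "\<dots> = (if a \<in> A then
      (\<Sum>p<n. map_mat cnj (fourier (M * n)) $$ (x, a * n + p) * baker_block \<chi> n $$ (p, q)) else 0)"
    using assms by simp
  also have "(\<Sum>p<n. map_mat cnj (fourier (M * n)) $$ (x, a * n + p) * baker_block \<chi> n $$ (p, q))
      = (\<Sum>p<n. ?c * (of_real (\<chi> (real p / real n)) * cis (2 * pi * ?\<theta>) ^ p))"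
  proof (rule sum.cong)
    fix p assume "p \<in> {..<n}"
    then have p: "p < n" by simp
    have ang: "cis (2 * pi * real x * real (a * n
        + p) / real (M * n)) * cis (- (2 * pi * real p * real q / real n))
        = cis (2 * pi * real a * real x / real M) * cis (2 * pi * ?\<theta>) ^ p"
      unfolding Complex.DeMoivre cis_mult
      by (rule arg_cong[of _ _ cis]) (use assms(1) M in \<open>simp add: field_simps\<close>)
    have "map_mat cnj (fourier (M * n)) $$ (x, a * n + p) * baker_block \<chi> n $$ (p, q)
      = (cis (2 * pi * real x * real (a * n + p) / real (M * n)) * cis (- (2 * pi * real p * real q / real n))) *
        (of_real (\<chi> (real p / real n)) * of_real (\<chi> (real q / real n)) /
          (of_real (sqrt (real (M * n))) * of_real (sqrt (real n))))"
      using assms p block_index_less[OF assms(4) p]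
      by (simp add: fourier_index baker_block_index cis_cnj)
    then show "map_mat cnj (fourier (M * n)) $$ (x, a * n + p) * baker_block \<chi> n $$ (p, q)
      = ?c * (of_real (\<chi> (real p / real n)) * cis (2 * pi * ?\<theta>) ^ p)"
      unfolding ang by simp
  qed simp
  also have "\<dots> = ?c * (\<Sum>p<n. of_real (\<chi> (real p / real n)) * cis (2 * pi * ?\<theta>) ^ p)"
    by (rule sum_distrib_left[symmetric])
  finally show ?thesis by (simp add: norm_mult norm_divide)
qed

text \<open>
  The quantum map follows the classical one: a column with leading digit outside \<open>A\<close> is zero, and
  otherwise the entry decays to any order in the distance from \<open>x / M\<close> to \<open>q\<close>, uniformly in the
  dimension.
\<close>

lemma baker_map_kernel_decay:
  assumes "\<chi> \<in> cutoffs" "A \<subseteq> {..<M}"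
  obtains K where "0 \<le> K"
    "\<And>n x a q. 0 < n \<Longrightarrow> x < M * n \<Longrightarrow> a < M \<Longrightarrow> q < n \<Longrightarrow> a \<notin> A \<Longrightarrow>
        baker_map M A \<chi> (M * n) $$ (x, a * n + q) = 0"
    "\<And>n x a q. 0 < n \<Longrightarrow> x < M * n \<Longrightarrow> a < M \<Longrightarrow> q < n \<Longrightarrow>
        cmod (baker_map M A \<chi> (M * n) $$ (x, a * n + q)) * \<bar>real x / real M - real q\<bar> ^ L \<le> K"
proof -
  obtain \<delta> where \<delta>: "0 < \<delta>" "\<delta> \<le> 1" and supp: "\<And>x. \<chi> x \<noteq> 0 \<Longrightarrow> \<delta> \<le> x \<and> x \<le> 1 - \<delta>"
    using cutoff_support[OF assms(1)] by blast
  obtain K where K: "0 \<le> K" "\<And>n \<theta>. 1 \<le> n \<Longrightarrow> \<bar>\<theta>\<bar> \<le> 1 - \<delta> \<Longrightarrow>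
      cmod (\<Sum>p<n. of_real (\<chi> (real p / real n)) * cis (2 * pi * \<theta>) ^ p) * (real n * \<bar>\<theta>\<bar>) ^ L
        \<le> K * real n"
    using nonstationary_phase[OF assms(1) \<delta>, of L] by blast
  show ?thesis
  proof
    show "0 \<le> K" by fact
    fix n x a q assume n: "0 < (n::nat)" and x: "x < M * n" and a: "a < M" and q: "q < n"
    note idx = baker_map_index[OF n assms(2) x a q, of \<chi>]
    show "baker_map M A \<chi> (M * n) $$ (x, a * n + q) = 0" if "a \<notin> A"
      using idx that by simp
    define \<theta> where "\<theta> = real x / real (M * n) - real q / real n"
    have \<theta>: "\<bar>real x / real M - real q\<bar> = real n * \<bar>\<theta>\<bar>"
    proof -
      have "real x / real M - real q = real n * \<theta>" using n by (simp add: \<theta>_def field_simps)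
      then show ?thesis by (simp add: abs_mult)
    qed
    let ?S = "cmod (\<Sum>p<n. of_real (\<chi> (real p / real n)) * cis (2 * pi * \<theta>) ^ p)"
    show "cmod (baker_map M A \<chi> (M * n) $$ (x, a * n + q)) * \<bar>real x / real M - real q\<bar> ^ L \<le> K"
    proof (cases "a \<in> A \<and> \<chi> (real q / real n) \<noteq> 0")
      case False
      then show ?thesis using idx K by auto
    next
      case True
      then have q': "\<delta> \<le> real q / real n" "real q / real n \<le> 1 - \<delta>" using supp by auto
      have "real x < real (M * n)" using x by (simp only: of_nat_less_iff)
      then have "0 \<le> real x / real (M * n)" "real x / real (M * n) < 1"
        by (simp_all add: divide_less_eq)
      \<comment> \<open>The support of \<open>\<chi>\<close> keeps \<open>q / n\<close> away from both ends of the unit interval, which prevents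
        \<open>\<theta>\<close> from approaching the integers other than \<open>0\<close>.\<close>
      with q' have "\<bar>\<theta>\<bar> \<le> 1 - \<delta>" unfolding \<theta>_def by linarith
      then have S: "?S * (real n * \<bar>\<theta>\<bar>) ^ L \<le> K * real n" using K(2)[of n \<theta>] n by simp
      have sq: "real n \<le> sqrt (real (M * n)) * sqrt (real n)"
      proof -
        have "sqrt (real n) * sqrt (real n) \<le> sqrt (real (M * n)) * sqrt (real n)"
          using a mult_right_mono[of 1 "real M" "real n"] by (intro mult_right_mono) auto
        then show ?thesis by simp
      qed
      have \<chi>1: "\<bar>\<chi> (real q / real n)\<bar> \<le> 1" using assms(1) by (simp add: cutoffs_def)
      have "\<bar>\<chi> (real q / real n)\<bar> / (sqrt (real (M * n)) * sqrt (real n)) \<le> 1 / real n"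
        using n sq \<chi>1 by (intro frac_le) auto
      then have "cmod (baker_map M A \<chi> (M * n) $$ (x, a * n + q)) \<le> 1 / real n * ?S"
        unfolding idx \<theta>_def using True by (simp only: if_True) (intro mult_right_mono, auto)
      then have "cmod (baker_map M A \<chi> (M * n) $$ (x, a * n + q)) * (real n * \<bar>\<theta>\<bar>) ^ L
          \<le> 1 / real n * ?S * (real n * \<bar>\<theta>\<bar>) ^ L"
        by (intro mult_right_mono) auto
      also have "\<dots> \<le> 1 / real n * (K * real n)"
        using mult_left_mono[OF S, of "1 / real n"] by (simp only: mult.assoc) simp
      also have "\<dots> = K" using n by simp
      finally show ?thesis unfolding \<theta> .
    qed
  qed
qed

section \<open>Cantor sets and their neighbourhoods\<close>

lemma cantor_0: "cantor M A 0 = {0}"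
  by (auto simp: cantor_def)

lemma cantor_Suc: "cantor M A (Suc k) = {c + a * M ^ k | c a. c \<in> cantor M A k \<and> a \<in> A}"
proof (intro Set.set_eqI iffI)
  fix y assume "y \<in> cantor M A (Suc k)"
  then obtain f where f: "y = (\<Sum>j<Suc k. f j * M ^ j)" "\<forall>j<Suc k. f j \<in> A"
    unfolding cantor_def by blast
  then have "(\<Sum>j<k. f j * M ^ j) \<in> cantor M A k" "f k \<in> A"
    unfolding cantor_def by auto
  then show "y \<in> {c + a * M ^ k | c a. c \<in> cantor M A k \<and> a \<in> A}"
    using f(1) by auto
next
  fix y assume "y \<in> {c + a * M ^ k | c a. c \<in> cantor M A k \<and> a \<in> A}"
  then obtain f a where "y = (\<Sum>j<k. f j * M ^ j) + a * M ^ k" "\<forall>j<k. f j \<in> A" "a \<in> A"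
    unfolding cantor_def by blast
  then have "y = (\<Sum>j<Suc k. (f(k := a)) j * M ^ j)" "\<forall>j<Suc k. (f(k := a)) j \<in> A"
    by (auto simp: less_Suc_eq)
  then show "y \<in> cantor M A (Suc k)" unfolding cantor_def by blast
qed

lemma cantor_less:
  assumes "A \<subseteq> {..<M}" "c \<in> cantor M A k"
  shows "c < M ^ k"
  using assms(2)
proof (induction k arbitrary: c)
  case (Suc k)
  then obtain c' a where c: "c = c' + a * M ^ k" "c' \<in> cantor M A k" "a \<in> A"
    by (auto simp: cantor_Suc)
  then have "c' < M ^ k" "a < M" using Suc.IH assms(1) by auto
  then show ?case using c(1) block_index_less[of a M c' "M ^ k"] by (simp add: add.commute)
qed (simp add: cantor_0)

text \<open>
  Concatenation of digit strings.
\<close>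

lemma cantor_append:
  assumes "d \<in> cantor M A s" "c \<in> cantor M A m"
  shows "d + M ^ s * c \<in> cantor M A (s + m)"
  using assms(2)
proof (induction m arbitrary: c)
  case (Suc m)
  then obtain c' a where c: "c = c' + a * M ^ m" "c' \<in> cantor M A m" "a \<in> A"
    by (auto simp: cantor_Suc)
  then have "d + M ^ s * c' \<in> cantor M A (s + m)" using Suc.IH by simp
  moreover have "d + M ^ s * c = (d + M ^ s * c') + a * M ^ (s + m)"
    by (simp add: c(1) algebra_simps power_add)
  ultimately show ?case using c(3) unfolding add_Suc_right cantor_Suc by blast
qed (use assms(1) in \<open>simp add: cantor_0\<close>)

lemma cantor_nonempty: "A \<noteq> {} \<Longrightarrow> cantor M A k \<noteq> {}"
  by (induction k) (auto simp: cantor_0 cantor_Suc)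

text \<open>
  The interval from \<open>M ^ (k - j) * c\<close> to \<open>M ^ (k - j) * (c + 1)\<close> collects the numbers with \<open>k\<close> digits whose
  \<open>j\<close> leading digits spell \<open>c\<close>. Thus this is the set of positions from which \<open>j\<close> steps of the expanding map
  stay inside the digits \<open>A\<close>, thickened by \<open>2 * R\<close>.
\<close>

definition cantor_nbhd :: "nat \<Rightarrow> nat set \<Rightarrow> nat \<Rightarrow> real \<Rightarrow> nat \<Rightarrow> nat set" where
  "cantor_nbhd M A k R j = {y. \<exists>c\<in>cantor M A j.
     real M ^ (k - j) * real c - 2 * R \<le> real y \<and> real y \<le> real M ^ (k - j) * (real c + 1) + 2 * R}"

lemma cantor_nbhd_0: "0 \<le> R \<Longrightarrow> y < M ^ k \<Longrightarrow> y \<in> cantor_nbhd M A k R 0"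
proof -
  assume "0 \<le> R" "y < M ^ k"
  then have "real y < real M ^ k" by (simp flip: of_nat_power)
  then have "- 2 * R \<le> real y" "real y \<le> real M ^ k + 2 * R" using \<open>0 \<le> R\<close> by linarith+
  then show ?thesis by (simp add: cantor_nbhd_def cantor_0 del: of_nat_le_iff)
qed

text \<open>
  One backward step of the expanding map with an error of size \<open>R\<close> prepends the digit \<open>a\<close> to the \<open>j\<close>
  leading digits already known to lie in \<open>A\<close>.
\<close>

lemma cantor_nbhd_step:
  assumes "2 \<le> M" "j \<le> k" "0 \<le> R" "a \<in> A"
    and "x \<in> cantor_nbhd M A (Suc k) R j" "\<bar>real x / real M - real q\<bar> \<le> R"
  shows "a * M ^ k + q \<in> cantor_nbhd M A (Suc k) R (Suc j)"
proof -
  define E where "E = real M ^ (k - j)"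
  have E: "real M ^ (Suc k - j) = real M * E" using assms(2) by (simp add: E_def Suc_diff_le)
  have Ek: "real M ^ k = E * real M ^ j" using assms(2) by (simp add: E_def flip: power_add)
  obtain c where c: "c \<in> cantor M A j" "real M * E * real c - 2 * R \<le> real x"
      "real x \<le> real M * E * (real c + 1) + 2 * R"
    using assms(5) unfolding cantor_nbhd_def E by blast
  have M: "0 < real M" using assms(1) by simp
  \<comment> \<open>The radius \<open>2 * R\<close> reproduces itself: it is contracted by \<open>M\<close> and then enlarged by \<open>R\<close>.\<close>
  have RM: "2 * R / real M \<le> R"
    using mult_right_mono[of 2 "real M" R] assms(1,3) M by (simp add: pos_divide_le_eq mult.commute)
  have "(real M * E * real c - 2 * R) / real M \<le> real x / real M"
    using c(2) M by (intro divide_right_mono) auto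
  then have "E * real c - 2 * R / real M \<le> real x / real M"
    using M by (simp add: diff_divide_distrib)
  then have 1: "E * real c - 2 * R \<le> real q" using RM assms(6) by linarith
  have "real x / real M \<le> (real M * E * (real c + 1) + 2 * R) / real M"
    using c(3) M by (intro divide_right_mono) auto
  then have "real x / real M \<le> E * (real c + 1) + 2 * R / real M"
    using M by (simp add: add_divide_distrib)
  then have 2: "real q \<le> E * (real c + 1) + 2 * R" using RM assms(6) by linarith
  have y: "real (a * M ^ k + q) = E * (real a * real M ^ j) + real q"
    by (simp add: Ek)
  have "c + a * M ^ j \<in> cantor M A (Suc j)" using c(1) assms(4) by (auto simp: cantor_Suc)
  moreover have "real M ^ (Suc k - Suc j) * real (c + a * M ^ j) - 2 * R \<le> real (a * M ^ k + q)"
    "real (a * M ^ k + q) \<le> real M ^ (Suc k - Suc j) * (real (c + a * M ^ j) + 1) + 2 * R"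
    using 1 2 unfolding y by (simp_all add: E_def[symmetric] algebra_simps)
  ultimately show ?thesis unfolding cantor_nbhd_def by blast
qed

text \<open>
  When the thickening matches the length of the intervals, every point is within four such lengths of a
  point of the full Cantor set, obtained by filling in the missing low digits.
\<close>

lemma cantor_nbhd_subset_translates:
  assumes "A \<subseteq> {..<M}" "A \<noteq> {}" "m \<le> k" "R = real (M ^ (k - m))"
    and y: "y \<in> cantor_nbhd M A k R m"
  shows "\<exists>c\<in>cantor M A k. \<exists>t\<in>{- 4 * int (M ^ (k - m))..4 * int (M ^ (k - m))}. int y = int c + t"
proof -
  define S where "S = M ^ (k - m)"
  have SR: "real M ^ (k - m) = real S" "R = real S" using assms(4) by (simp_all add: S_def)
  obtain c where c: "c \<in> cantor M A m" "real M ^ (k - m) * real c - 2 * R \<le> real y"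
      "real y \<le> real M ^ (k - m) * (real c + 1) + 2 * R"
    using y by (auto simp: cantor_nbhd_def)
  \<comment> \<open>any admissible choice of the \<open>k - m\<close> low digits will do\<close>
  obtain d where d: "d \<in> cantor M A (k - m)" using cantor_nonempty[OF assms(2)] by blast
  have dS: "int d < int S" using cantor_less[OF assms(1) d] by (simp add: S_def)
  have "d + S * c \<in> cantor M A (k - m + m)" unfolding S_def by (rule cantor_append[OF d c(1)])
  then have mem: "d + S * c \<in> cantor M A k" using assms(3) by simp
  have "real_of_int (int S * int c - 2 * int S) \<le> real_of_int (int y)"
    "real_of_int (int y) \<le> real_of_int (int S * (int c + 1) + 2 * int S)"
    using c unfolding SR by simp_all
  then have "int S * int c - 2 * int S \<le> int y" "int y \<le> int S * (int c + 1) + 2 * int S"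
    by (simp_all only: of_int_le_iff)
  then have "int y - int (d + S * c) \<in> {- 4 * int S..4 * int S}"
    using dS by (simp add: algebra_simps)
  then show ?thesis using mem unfolding S_def[symmetric]
      by (intro bexI[of _ "d + S * c"] bexI[of _ "int y - int (d + S * c)"]) auto
qed

section \<open>Localisation of the iterated map\<close>

lemma indicator_op_carrier [simp]: "indicator_op N X \<in> carrier_mat N N"
  by (simp add: indicator_op_def)

lemma indicator_op_dim [simp]: "dim_row (indicator_op N X) = N" "dim_col (indicator_op N X) = N"
  using indicator_op_carrier by blast+

lemma indicator_op_transpose: "transpose_mat (indicator_op N X) = indicator_op N X"
  by (rule eq_matI) (auto simp: indicator_op_def mat_diag_def)

lemma op_bound_indicator: "op_bound (indicator_op N X) 1"
  unfolding indicator_op_def by (rule op_bound_diag) (simp add: indicator_def)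

lemma indicator_op_mult_vec:
  assumes "u \<in> carrier_vec N" "i < N"
  shows "(indicator_op N X *\<^sub>v u) $ i = indicator X i * u $ i"
  using assms unfolding indicator_op_def
  by (subst mult_mat_vec_index_sum[of _ N N]) (auto simp: mat_diag_def if_distrib if_distribR cong: if_cong)

lemma indicator_op_split:
  assumes "u \<in> carrier_vec N"
  shows "indicator_op N X *\<^sub>v u + indicator_op N (- X) *\<^sub>v u = u"
  using assms
  by (intro eq_vecI) (auto simp: indicator_op_mult_vec indicator_def simp del: index_mult_mat_vec)

lemma indicator_sandwich_index:
  assumes "T \<in> carrier_mat N N" "i < N" "j < N"
  shows "(indicator_op N X * T * indicator_op N Y) $$ (i, j)
      = indicator X i * T $$ (i, j) * indicator Y j"
  using assms unfolding indicator_op_def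
  by (subst mat_diag_mult_left[of _ N N], simp, subst mat_diag_mult_right[of _ N N]) auto

lemma transpose_sandwich:
  assumes "T \<in> carrier_mat N N"
  shows "transpose_mat (indicator_op N X * T * indicator_op N Y)
    = indicator_op N Y * transpose_mat T * indicator_op N X"
proof -
  have XT: "indicator_op N X * T \<in> carrier_mat N N"
      by (rule mult_carrier_mat[OF indicator_op_carrier assms])
  have TT: "transpose_mat T \<in> carrier_mat N N" using assms by simp
  show ?thesis
    unfolding transpose_mult[OF XT indicator_op_carrier] transpose_mult[OF indicator_op_carrier assms]
      indicator_op_transpose
    by (rule assoc_mult_mat[OF indicator_op_carrier TT indicator_op_carrier, symmetric])
qed

lemma op_bound_sandwich_entries:
  assumes "T \<in> carrier_mat N N" "0 \<le> e"
    and "\<And>i j. i < N \<Longrightarrow> j < N \<Longrightarrow> i \<in> X \<Longrightarrow> j \<in> Y \<Longrightarrow> cmod (T $$ (i, j)) \<le> e"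
  shows "op_bound (indicator_op N X * T * indicator_op N Y) (real N * e)"
proof -
  let ?T = "indicator_op N X * T * indicator_op N Y"
  have "?T \<in> carrier_mat N N"
    by (intro mult_carrier_mat[of _ N N]) (use assms in simp_all)
  then have dim: "dim_row ?T = N" "dim_col ?T = N" by auto
  have "op_bound ?T (sqrt (real (dim_row ?T)) * sqrt (real (dim_col ?T)) * e)"
  proof (rule op_bound_entries)
    fix i j assume "i < dim_row ?T" "j < dim_col ?T"
    then have "i < N" "j < N" using dim by auto
    then show "cmod (?T $$ (i, j)) \<le> e"
      unfolding indicator_sandwich_index[OF assms(1) \<open>i < N\<close> \<open>j < N\<close>]
      using assms(2,3) by (auto simp: indicator_def)
  qed (use assms in simp)
  then show ?thesis unfolding dim by simp
qed

text \<open>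
  If the contraction \<open>B\<close> transports almost nothing from outside \<open>X (j + 1)\<close> into \<open>X j\<close>, then mass starting
  outside \<open>X m\<close> avoids \<open>X (m - 1)\<close>, then \<open>X (m - 2)\<close>, and so on down to \<open>X 0\<close>, which is everything. Every step
  leaks at most \<open>\<epsilon>\<close>.
\<close>

lemma op_bound_iterate_localized:
  assumes B: "B \<in> carrier_mat N N" "op_bound B 1" and "0 \<le> \<epsilon>"
    and X0: "{..<N} \<subseteq> X 0"
    and step: "\<And>j. j < m \<Longrightarrow> op_bound (indicator_op N (X j) * B * indicator_op N (- X (Suc j))) \<epsilon>"
  shows "op_bound (B ^\<^sub>m m * indicator_op N (- X m)) (real m * \<epsilon>)"
  using step
proof (induction m)
  case 0
  show ?case unfolding op_bound_def
  proof
    fix u :: "complex vec" assume "u \<in> carrier_vec (dim_col (B ^\<^sub>m 0 * indicator_op N (- X 0)))"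
    then have u: "u \<in> carrier_vec N" by simp
    have "indicator_op N (- X 0) *\<^sub>v u = 0\<^sub>v N"
      using u X0 by (intro eq_vecI)
        (auto simp: indicator_op_mult_vec indicator_def simp del: index_mult_mat_vec)
    then have "(B ^\<^sub>m 0 * indicator_op N (- X 0)) *\<^sub>v u = 0\<^sub>v N"
      using B(1) by simp
    then show "l2norm ((B ^\<^sub>m 0 * indicator_op N (- X 0)) *\<^sub>v u) \<le> real 0 * \<epsilon> * l2norm u"
      by simp
  qed
next
  case (Suc m)
  let ?Q = "indicator_op N (- X (Suc m))" and ?P = "indicator_op N (X m)" and ?R = "indicator_op N (- X m)"
  let ?W = "B ^\<^sub>m m"
  have IH: "op_bound (?W * ?R) (real m * \<epsilon>)" using Suc by simp
  have W: "?W \<in> carrier_mat N N" by (rule pow_carrier_mat[OF B(1)])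
  have BQ: "B * ?Q \<in> carrier_mat N N" by (rule mult_carrier_mat[OF B(1) indicator_op_carrier])
  show ?case unfolding op_bound_def
  proof
    fix u :: "complex vec" assume "u \<in> carrier_vec (dim_col (B ^\<^sub>m Suc m * ?Q))"
    then have u: "u \<in> carrier_vec N" by simp
    define w where "w = (B * ?Q) *\<^sub>v u"
    have w: "w \<in> carrier_vec N" unfolding w_def by (rule mult_mat_vec_carrier[OF BQ u])
    have wR: "?R *\<^sub>v w \<in> carrier_vec N" and wP: "?P *\<^sub>v w \<in> carrier_vec N"
      by (rule mult_mat_vec_carrier[OF indicator_op_carrier w])+
    have "(B ^\<^sub>m Suc m * ?Q) *\<^sub>v u = ?W *\<^sub>v w"
      unfolding w_def pow_mat.simps assoc_mult_mat[OF W B(1) indicator_op_carrier]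
      by (rule assoc_mult_mat_vec[OF W BQ u])
    also have "\<dots> = ?W *\<^sub>v (?P *\<^sub>v w + ?R *\<^sub>v w)"
      by (simp only: indicator_op_split[OF w])
    also have "\<dots> = ?W *\<^sub>v (?P *\<^sub>v w) + ?W *\<^sub>v (?R *\<^sub>v w)"
      by (rule mult_add_distrib_mat_vec[OF W wP wR])
    finally have "l2norm ((B ^\<^sub>m Suc m * ?Q) *\<^sub>v u)
        \<le> l2norm (?W *\<^sub>v (?P *\<^sub>v w)) + l2norm (?W *\<^sub>v (?R *\<^sub>v w))"
      using W by (simp add: l2norm_add)
    moreover have "l2norm (?W *\<^sub>v (?P *\<^sub>v w)) \<le> \<epsilon> * l2norm u"
    proof -
      have "l2norm (?W *\<^sub>v (?P *\<^sub>v w)) \<le> 1 * l2norm (?P *\<^sub>v w)"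
        by (rule op_boundD[OF op_bound_pow[OF B]]) (use W wP in auto)
      moreover have "?P *\<^sub>v w = (?P * B * ?Q) *\<^sub>v u"
        unfolding w_def assoc_mult_mat[OF indicator_op_carrier B(1) indicator_op_carrier]
        by (rule assoc_mult_mat_vec[OF indicator_op_carrier BQ u, symmetric])
      moreover have "l2norm ((?P * B * ?Q) *\<^sub>v u) \<le> \<epsilon> * l2norm u"
        by (rule op_boundD[OF Suc.prems]) (use u in auto)
      ultimately show ?thesis by simp
    qed
    moreover have "l2norm (?W *\<^sub>v (?R *\<^sub>v w)) \<le> real m * \<epsilon> * l2norm u"
    proof -
      have "l2norm ((?W * ?R) *\<^sub>v w) \<le> real m * \<epsilon> * l2norm w"
        by (rule op_boundD[OF IH]) (use w in auto)
      also have "?W * ?R *\<^sub>v w = ?W *\<^sub>v (?R *\<^sub>v w)"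
        by (rule assoc_mult_mat_vec[OF W indicator_op_carrier w])
      finally have "l2norm (?W *\<^sub>v (?R *\<^sub>v w)) \<le> real m * \<epsilon> * l2norm w" .
      moreover have "l2norm w \<le> 1 * 1 * l2norm u"
        unfolding w_def
        by (rule op_boundD[OF op_bound_mult[OF B(2) op_bound_indicator _ B(1) indicator_op_carrier]])
          (use u in auto)
      then have "real m * \<epsilon> * l2norm w \<le> real m * \<epsilon> * l2norm u"
        using \<open>0 \<le> \<epsilon>\<close> by (intro mult_left_mono) auto
      ultimately show ?thesis by linarith
    qed
    ultimately show "l2norm ((B ^\<^sub>m Suc m * ?Q) *\<^sub>v u) \<le> real (Suc m) * \<epsilon> * l2norm u"
      by (simp add: algebra_simps)
  qed
qed

text \<open>
  A transition from outside the \<open>(j + 1)\<close>-st neighbourhood into the \<open>j\<close>-th one either starts at a leading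
  digit outside \<open>A\<close>, or misses the classical trajectory by more than \<open>R\<close> by \<open>cantor_nbhd_step\<close>; so its
  matrix entry is zero or at most \<open>K / R ^ L\<close>.
\<close>

lemma baker_map_localized:
  assumes A: "A \<subseteq> {..<M}" and \<chi>: "\<chi> \<in> cutoffs" and M: "2 \<le> M" and "0 < R" "0 \<le> K"
    and vanish: "\<And>x a q. x < M * M ^ k \<Longrightarrow> a < M \<Longrightarrow> q < M ^ k \<Longrightarrow> a \<notin> A \<Longrightarrow>
        baker_map M A \<chi> (M * M ^ k) $$ (x, a * M ^ k + q) = 0"
    and decay: "\<And>x a q. x < M * M ^ k \<Longrightarrow> a < M \<Longrightarrow> q < M ^ k \<Longrightarrow>
        cmod (baker_map M A \<chi> (M * M ^ k) $$ (x, a * M ^ k + q)) * \<bar>real x / real M - real q\<bar> ^ L \<le> K"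
    and "m \<le> Suc k"
  shows "op_bound (baker_map M A \<chi> (M ^ Suc k) ^\<^sub>m m
      * indicator_op (M ^ Suc k) (- cantor_nbhd M A (Suc k) R m)) (real m * (real (M ^ Suc k) * (K / R ^ L)))"
proof (rule op_bound_iterate_localized[where X = "cantor_nbhd M A (Suc k) R"])
  let ?N = "M ^ Suc k"
  show "op_bound (baker_map M A \<chi> ?N) 1"
    using op_bound_baker_map[OF \<chi> _ A, of "M ^ k"] M by simp
  show "0 \<le> real ?N * (K / R ^ L)" using assms by simp
  show "{..<?N} \<subseteq> cantor_nbhd M A (Suc k) R 0"
    using cantor_nbhd_0[of R _ M "Suc k" A] \<open>0 < R\<close> by auto
  fix j assume j: "j < m"
  show "op_bound (indicator_op ?N (cantor_nbhd M A (Suc k) R j) * baker_map M A \<chi> ?N *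
      indicator_op ?N (- cantor_nbhd M A (Suc k) R (Suc j))) (real ?N * (K / R ^ L))"
  proof (rule op_bound_sandwich_entries)
    fix x y assume x: "x < ?N" "x \<in> cantor_nbhd M A (Suc k) R j"
      and y: "y < ?N" "y \<in> - cantor_nbhd M A (Suc k) R (Suc j)"
    define a q where "a = y div M ^ k" and "q = y mod M ^ k"
    have yaq: "y = a * M ^ k + q" unfolding a_def q_def by (rule div_mult_mod_eq[symmetric])
    have a: "a < M" unfolding a_def using y(1) M by (simp add: less_mult_imp_div_less)
    have q: "q < M ^ k" unfolding q_def using M by simp
    show "cmod (baker_map M A \<chi> ?N $$ (x, y)) \<le> K / R ^ L"
    proof (cases "a \<in> A")
      case False
      then show ?thesis using vanish[OF _ a q, of x] x(1) assms yaq by simp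
    next
      case True
      have "\<not> \<bar>real x / real M - real q\<bar> \<le> R"
        using cantor_nbhd_step[OF M _ _ True x(2), of q] y(2) j \<open>m \<le> Suc k\<close> \<open>0 < R\<close>
        by (auto simp: yaq)
      then have "R ^ L \<le> \<bar>real x / real M - real q\<bar> ^ L"
        using \<open>0 < R\<close> by (intro power_mono) auto
      then have "cmod (baker_map M A \<chi> ?N $$ (x, y)) * R ^ L
          \<le> cmod (baker_map M A \<chi> ?N $$ (x, y)) * \<bar>real x / real M - real q\<bar> ^ L"
        by (intro mult_left_mono) auto
      also have "\<dots> \<le> K" using decay[OF _ a q, of x] x(1) yaq by simp
      finally show ?thesis using \<open>0 < R\<close> by (simp add: pos_le_divide_eq)
    qed
  qed (use assms in auto)
qed (use assms in auto)

section \<open>The uncertainty principle for neighbourhoods\<close>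

text \<open>
  Covering \<open>X\<close> by translates of \<open>C\<close> costs at most one factor of the number of translates, because every
  translate satisfies the same bound as \<open>C\<close> itself.
\<close>

lemma op_bound_fourier_translates:
  fixes T :: "int set"
  assumes "0 < N" "C \<subseteq> {..<N}" "finite T" "0 \<le> r"
    and X: "\<And>x. x \<in> X \<Longrightarrow> x < N \<Longrightarrow> \<exists>c\<in>C. \<exists>t\<in>T. int x = int c + t"
    and bound: "op_bound (indicator_op N C * fourier N * indicator_op N Y) r"
  shows "op_bound (indicator_op N X * fourier N * indicator_op N Y) (real (card T) * r)"
  unfolding op_bound_def
proof
  let ?X = "indicator_op N X * fourier N * indicator_op N Y"
  let ?C = "indicator_op N C * fourier N * indicator_op N Y"
  have car: "indicator_op N Z * fourier N * indicator_op N Y \<in> carrier_mat N N" for Z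
    by (intro mult_carrier_mat[of _ N N]) simp_all
  fix u :: "complex vec" assume "u \<in> carrier_vec (dim_col ?X)"
  then have u: "u \<in> carrier_vec N" by simp
  \<comment> \<open>Translating the frequency by \<open>t\<close> is the same as modulating \<open>u\<close>, which commutes with the
    restriction to \<open>Y\<close> and preserves the norm.\<close>
  define tw where "tw t = vec N (\<lambda>y. cis (- (2 * pi * real_of_int t * real y / real N)) * u $ y)" for t
  have tw: "tw t \<in> carrier_vec N" for t by (simp add: tw_def)
  have norm_tw: "l2norm (tw t) = l2norm u" for t
    using u by (simp add: l2norm_def tw_def norm_mult)
  have entry: "((indicator_op N Z * fourier N * indicator_op N Y) *\<^sub>v v) $ x
      = indicator Z x * (\<Sum>y<N. fourier N $$ (x, y) * indicator Y y * v $ y)"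
    if "x < N" "v \<in> carrier_vec N" for Z x v
    using that
    by (subst mult_mat_vec_index_sum[OF car])
      (auto simp: indicator_sandwich_index sum_distrib_left mult_ac simp del: index_mult_mat(1) intro!: sum.cong)
  have shift: "(?X *\<^sub>v u) $ x = (?C *\<^sub>v tw t) $ c"
    if "x \<in> X" "x < N" "c \<in> C" "int x = int c + t" for x c t
  proof -
    have c: "c < N" using that assms(2) by auto
    have "real_of_int (int x) = real_of_int (int c + t)" using that(4) by (rule arg_cong)
    then have xr: "real x = real c + real_of_int t" by simp
    have "fourier N $$ (x, y) * indicator Y y * u $ y = fourier N $$ (c, y) * indicator Y y * tw t $ y"
      if "y < N" for y
    proof -
      have "cis (- (2 * pi * real x * real y / real N))
          = cis (- (2 * pi * real c * real y / real N)) * cis (- (2 * pi * real_of_int t * real y / real N))"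
        unfolding cis_mult by (rule arg_cong[of _ _ cis]) (use assms(1) in \<open>simp add: xr field_simps\<close>)
      then show ?thesis using that \<open>x < N\<close> c by (simp add: fourier_index tw_def mult_ac)
    qed
    then have "(\<Sum>y<N. fourier N $$ (x, y) * indicator Y y * u $ y)
        = (\<Sum>y<N. fourier N $$ (c, y) * indicator Y y * tw t $ y)"
      by (intro sum.cong refl) (simp only: lessThan_iff)
    then show ?thesis using that c u tw by (simp add: entry del: index_mult_mat_vec)
  qed
  \<comment> \<open>a point of \<open>X\<close> may lie in several translates; it is charged to just one of them\<close>
  obtain f g where fg: "\<And>x. x \<in> X \<Longrightarrow> x < N \<Longrightarrow> f x \<in> C \<and> g x \<in> T \<and> int x = int (f x) + g x"
    using X by metis
  have finC: "finite C" using assms(2) finite_subset by blast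
  have "(l2norm (?X *\<^sub>v u))\<^sup>2 = (\<Sum>x<N. (cmod ((?X *\<^sub>v u) $ x))\<^sup>2)"
    by (simp add: l2norm_power2 del: index_mult_mat_vec)
  also have "\<dots> = (\<Sum>x\<in>X \<inter> {..<N}. (cmod ((?X *\<^sub>v u) $ x))\<^sup>2)"
    using u by (intro sum.mono_neutral_right)
      (auto simp: entry indicator_def simp del: index_mult_mat_vec split: if_splits)
  also have "\<dots> = (\<Sum>x\<in>X \<inter> {..<N}. (\<lambda>(c, t). (cmod ((?C *\<^sub>v tw t) $ c))\<^sup>2) (f x, g x))"
  proof (rule sum.cong)
    fix x assume "x \<in> X \<inter> {..<N}"
    then have x: "x \<in> X" "x < N" by auto
    then show "(cmod ((?X *\<^sub>v u) $ x))\<^sup>2 = (\<lambda>(c, t). (cmod ((?C *\<^sub>v tw t) $ c))\<^sup>2) (f x, g x)"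
      using fg[OF x] shift[OF x, of "f x" "g x"] by (simp del: index_mult_mat_vec)
  qed simp
  also have "\<dots> = (\<Sum>(c, t)\<in>(\<lambda>x. (f x, g x)) ` (X \<inter> {..<N}). (cmod ((?C *\<^sub>v tw t) $ c))\<^sup>2)"
  proof -
    have "inj_on (\<lambda>x. (f x, g x)) (X \<inter> {..<N})"
    proof (rule inj_onI)
      fix x y assume xy: "x \<in> X \<inter> {..<N}" "y \<in> X \<inter> {..<N}" "(f x, g x) = (f y, g y)"
      then have "int x = int y" using fg[of x] fg[of y] by simp
      then show "x = y" by simp
    qed
    from sum.reindex[OF this, of "\<lambda>(c, t). (cmod ((?C *\<^sub>v tw t) $ c))\<^sup>2"]
    show ?thesis by (simp only: o_def)
  qed
  also have "\<dots> \<le> (\<Sum>(c, t)\<in>C \<times> T. (cmod ((?C *\<^sub>v tw t) $ c))\<^sup>2)"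
    using fg finC assms(3) by (intro sum_mono2) auto
  also have "\<dots> = (\<Sum>t\<in>T. \<Sum>c\<in>C. (cmod ((?C *\<^sub>v tw t) $ c))\<^sup>2)"
    by (subst sum.swap) (simp add: sum.cartesian_product)
  also have "\<dots> \<le> (\<Sum>t\<in>T. (r * l2norm u)\<^sup>2)"
  proof (rule sum_mono)
    fix t
    have "(\<Sum>c\<in>C. (cmod ((?C *\<^sub>v tw t) $ c))\<^sup>2) \<le> (\<Sum>c<N. (cmod ((?C *\<^sub>v tw t) $ c))\<^sup>2)"
      using assms(2) by (intro sum_mono2) auto
    also have "\<dots> = (l2norm (?C *\<^sub>v tw t))\<^sup>2"
      by (simp add: l2norm_power2 del: index_mult_mat_vec)
    also have "\<dots> \<le> (r * l2norm (tw t))\<^sup>2"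
      using tw by (intro power_mono op_boundD[OF bound]) auto
    finally show "(\<Sum>c\<in>C. (cmod ((?C *\<^sub>v tw t) $ c))\<^sup>2) \<le> (r * l2norm u)\<^sup>2"
      unfolding norm_tw .
  qed
  also have "\<dots> = real (card T) * (r * l2norm u)\<^sup>2" by simp
  also have "\<dots> \<le> (real (card T))\<^sup>2 * (r * l2norm u)\<^sup>2"
  proof (intro mult_right_mono)
    have "card T \<le> card T * card T" by simp
    then show "real (card T) \<le> (real (card T))\<^sup>2"
      unfolding power2_eq_square by (simp only: of_nat_mult[symmetric] of_nat_le_iff)
  qed simp
  also have "\<dots> = (real (card T) * r * l2norm u)\<^sup>2" by (simp add: power_mult_distrib)
  finally show "l2norm (?X *\<^sub>v u) \<le> real (card T) * r * l2norm u"
    by (rule power2_le_imp_le) (use assms(4) in simp)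
qed

text \<open>
  Enlarge the set on the left, transpose, and enlarge the other one.
\<close>

lemma op_bound_fourier_translates_both:
  fixes T :: "int set"
  assumes "0 < N" "C \<subseteq> {..<N}" "finite T" "0 \<le> r"
    and X: "\<And>x. x \<in> X \<Longrightarrow> x < N \<Longrightarrow> \<exists>c\<in>C. \<exists>t\<in>T. int x = int c + t"
    and bound: "op_bound (indicator_op N C * fourier N * indicator_op N C) r"
  shows "op_bound (indicator_op N X * fourier N * indicator_op N X) ((real (card T))\<^sup>2 * r)"
proof -
  have "op_bound (indicator_op N X * fourier N * indicator_op N C) (real (card T) * r)"
    by (rule op_bound_fourier_translates[OF assms(1-4) X bound])
  then have "op_bound (transpose_mat (indicator_op N X * fourier N
      * indicator_op N C)) (real (card T) * r)"
    by (rule op_bound_transpose) (use assms(4) in simp)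
  then have *: "op_bound (indicator_op N C * fourier N * indicator_op N X) (real (card T) * r)"
    by (simp add: transpose_sandwich fourier_symmetric)
  have "op_bound (indicator_op N X * fourier N * indicator_op N X) (real (card T) * (real (card T)
      * r))"
    by (rule op_bound_fourier_translates[OF assms(1-3) _ X *]) (use assms(4) in simp_all)
  then show ?thesis by (simp add: power2_eq_square mult.assoc)
qed

lemma fup_norm_bound:
  "op_bound (indicator_op (M ^ k) (cantor M A k) * fourier (M ^ k)
      * indicator_op (M ^ k) (cantor M A k))
     (fup_norm M A k)"
  unfolding fup_norm_def Let_def by (rule op_bound_opnorm)

text \<open>
  Unfolds the upper limit into a bound for all large \<open>k\<close>. The rate \<open>\<beta>\<close> is any real strictly between \<open>\<nu>\<close>
  and the exponent, which may be infinite a priori.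
\<close>

lemma fup_norm_decay:
  assumes "ereal \<nu> < fup_exponent M A" "1 < M"
  obtains \<beta> k0 where "\<nu> < \<beta>"
    "\<And>k. k0 \<le> k \<Longrightarrow> 1 \<le> k \<Longrightarrow> fup_norm M A k \<le> real M powr (- \<beta> * real k)"
proof -
  obtain \<beta> where \<beta>: "ereal \<nu> < ereal \<beta>" "ereal \<beta> < fup_exponent M A"
    using ereal_dense2[OF assms(1)] by blast
  then have "limsup (\<lambda>k. ereal (ln (fup_norm M A k) / (real k * ln (real M)))) < ereal (- \<beta>)"
    unfolding fup_exponent_def by (metis ereal_less_uminus_reorder uminus_ereal.simps(1))
  from Limsup_lessD[OF this] obtain k0 where
    k0: "\<And>k. k0 \<le> k \<Longrightarrow> ln (fup_norm M A k) / (real k * ln (real M)) < - \<beta>"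
    by (auto simp: eventually_sequentially)
  show ?thesis
  proof
    show "\<nu> < \<beta>" using \<beta>(1) by simp
    fix k assume k: "k0 \<le> k" "1 \<le> k"
    show "fup_norm M A k \<le> real M powr (- \<beta> * real k)"
    proof (cases "fup_norm M A k \<le> 0")
      case True
      then show ?thesis by (meson order_trans powr_ge_zero)
    next
      case False
      have "ln (fup_norm M A k) < - \<beta> * (real k * ln (real M))"
        using k0[OF k(1)] k(2) assms(2) by (simp add: pos_divide_less_eq)
      then have "fup_norm M A k < exp (- \<beta> * (real k * ln (real M)))"
        using False by (metis exp_less_cancel_iff exp_ln not_le)
      then show ?thesis using assms(2) by (simp add: powr_def mult_ac)
    qed
  qed
qed

section \<open>From localisation to the resolvent\<close>

text \<open>
  Telescoping \<open>B\<^sup>m - z\<^sup>m\<close>; both \<open>B\<close> and \<open>z\<close> are contractions, so each of the \<open>m\<close> terms is at most the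
  defect of the eigenvalue equation.
\<close>

lemma power_almost_eigenvector:
  assumes B: "B \<in> carrier_mat N N" "op_bound B 1" and z: "cmod z \<le> 1" and u: "u \<in> carrier_vec N"
  shows "l2norm (B ^\<^sub>m m *\<^sub>v u - z ^ m \<cdot>\<^sub>v u) \<le> real m * l2norm (B *\<^sub>v u - z \<cdot>\<^sub>v u)"
proof (induction m)
  case 0
  have "B ^\<^sub>m 0 *\<^sub>v u - z ^ 0 \<cdot>\<^sub>v u = 0\<^sub>v N" using B u by (intro eq_vecI) auto
  then show ?case by simp
next
  case (Suc m)
  define v where "v = B *\<^sub>v u - z \<cdot>\<^sub>v u"
  let ?W = "B ^\<^sub>m m"
  have W: "?W \<in> carrier_mat N N" by (rule pow_carrier_mat[OF B(1)])
  have Bu: "B *\<^sub>v u \<in> carrier_vec N" by (rule mult_mat_vec_carrier[OF B(1) u])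
  have v: "v \<in> carrier_vec N" unfolding v_def using Bu u by simp
  have "B *\<^sub>v u = v + z \<cdot>\<^sub>v u" unfolding v_def using B(1) u by (intro eq_vecI) auto
  then have "B ^\<^sub>m Suc m *\<^sub>v u = ?W *\<^sub>v (v + z \<cdot>\<^sub>v u)"
    using assoc_mult_mat_vec[OF W B(1) u] by simp
  also have "\<dots> = ?W *\<^sub>v v + z \<cdot>\<^sub>v (?W *\<^sub>v u)"
    using mult_add_distrib_mat_vec[OF W v smult_carrier_vec[THEN iffD2, OF u]] mult_mat_vec[OF W u]
    by simp
  finally have "B ^\<^sub>m Suc m *\<^sub>v u - z ^ Suc m \<cdot>\<^sub>v u
      = ?W *\<^sub>v v + z \<cdot>\<^sub>v (?W *\<^sub>v u - z ^ m \<cdot>\<^sub>v u)"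
    using W u v by (intro eq_vecI) (auto simp: algebra_simps simp del: index_mult_mat_vec)
  moreover have "l2norm (?W *\<^sub>v v + z \<cdot>\<^sub>v (?W *\<^sub>v u - z ^ m \<cdot>\<^sub>v u))
      \<le> l2norm (?W *\<^sub>v v) + l2norm (z \<cdot>\<^sub>v (?W *\<^sub>v u - z ^ m \<cdot>\<^sub>v u))"
    using W u B(1) by (intro l2norm_add) simp
  ultimately have "l2norm (B ^\<^sub>m Suc m *\<^sub>v u - z ^ Suc m \<cdot>\<^sub>v u)
      \<le> l2norm (?W *\<^sub>v v) + cmod z * l2norm (?W *\<^sub>v u - z ^ m \<cdot>\<^sub>v u)"
    by (simp only: l2norm_smult)
  also have "\<dots> \<le> 1 * l2norm v + 1 * (real m * l2norm v)"
    using op_boundD[OF op_bound_pow[OF B, of m]] W v z Suc.IH[folded v_def]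
    by (intro add_mono mult_mono) auto
  finally show ?case by (simp add: v_def algebra_simps)
qed

text \<open>
  Transposition reverses products, which is harmless for powers of a single matrix.
\<close>

lemma transpose_pow_intertwine:
  fixes B F :: "complex mat"
  assumes B: "B \<in> carrier_mat N N" and F: "F \<in> carrier_mat N N"
    and FB: "F * B = transpose_mat B * F"
  shows "F * B ^\<^sub>m m = transpose_mat (B ^\<^sub>m m) * F"
proof (induction m)
  case 0
  then show ?case using B F by simp
next
  case (Suc m)
  let ?W = "B ^\<^sub>m m"
  have W: "?W \<in> carrier_mat N N" by (rule pow_carrier_mat[OF B])
  have comm: "B * ?W = ?W * B" 
  proof (induction m)
    case (Suc m)
    have W: "B ^\<^sub>m m \<in> carrier_mat N N" by (rule pow_carrier_mat[OF B])
    show ?case using Suc assoc_mult_mat[OF B W B] by simp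
  qed (use B in simp)
  have T: "transpose_mat ?W \<in> carrier_mat N N" "transpose_mat B \<in> carrier_mat N N" using W B by auto
  have "F * B ^\<^sub>m Suc m = (F * ?W) * B" using assoc_mult_mat[OF F W B] by simp
  also have "\<dots> = transpose_mat ?W * (F * B)"
    unfolding Suc by (rule assoc_mult_mat[OF T(1) F B])
  also have "\<dots> = (transpose_mat ?W * transpose_mat B) * F"
    unfolding FB by (rule assoc_mult_mat[OF T F, symmetric])
  also have "transpose_mat ?W * transpose_mat B = transpose_mat (B ^\<^sub>m Suc m)"
    unfolding transpose_mult[OF B W, symmetric] comm by simp
  finally show ?case .
qed

text \<open>
  The heart of the argument. Up to the defect \<open>v = B u - z u\<close>, the vector \<open>z\<^sup>m u\<close> is \<open>B\<^sup>m u\<close>, hence it has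
  frequencies in \<open>X\<close> and is controlled
      by the part of \<open>u\<close> on \<open>X\<close>. The uncertainty principle makes these two
  facts incompatible unless \<open>u\<close> is small compared with \<open>v\<close>.
\<close>

lemma uncertainty_resolvent_bound:
  assumes N: "0 < N" and B: "B \<in> carrier_mat N N" "op_bound B 1"
    and FB: "fourier N * B = transpose_mat B * fourier N"
    and loc: "op_bound (B ^\<^sub>m m * indicator_op N (- X)) \<epsilon>" "0 \<le> \<epsilon>"
    and fup: "op_bound (indicator_op N X * fourier N * indicator_op N X) \<kappa>"
    and z: "cmod z \<le> 1" and u: "u \<in> carrier_vec N"
  shows "(cmod z ^ m)\<^sup>2 * l2norm u
    \<le> (cmod z ^ m * \<kappa> + 2 * \<epsilon>) * l2norm u + 2 * real m * l2norm (B *\<^sub>v u - z \<cdot>\<^sub>v u)"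
proof -
  let ?F = "fourier N" and ?G = "map_mat cnj (fourier N)"
  let ?P = "indicator_op N X" and ?Q = "indicator_op N (- X)" and ?W = "B ^\<^sub>m m"
  let ?v = "real m * l2norm (B *\<^sub>v u - z \<cdot>\<^sub>v u)"
  have W: "?W \<in> carrier_mat N N" by (rule pow_carrier_mat[OF B(1)])
  have G: "?G \<in> carrier_mat N N" by simp
  note F = fourier_carrier[of N] and ind = indicator_op_carrier[of N]
  have WQ: "?W * ?Q \<in> carrier_mat N N" by (rule mult_carrier_mat[OF W ind])
  define r where "r = ?W *\<^sub>v u - z ^ m \<cdot>\<^sub>v u"
  have r: "l2norm r \<le> ?v" unfolding r_def by (rule power_almost_eigenvector[OF B z u])
  have Wu: "?W *\<^sub>v u \<in> carrier_vec N" by (rule mult_mat_vec_carrier[OF W u])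
  have rc: "r \<in> carrier_vec N" unfolding r_def using Wu u by simp
  have zu: "z ^ m \<cdot>\<^sub>v u = ?W *\<^sub>v u - r" unfolding r_def using Wu u by (intro eq_vecI) auto
  define f where "f = ?F *\<^sub>v u"
  have f: "f \<in> carrier_vec N" unfolding f_def by (rule mult_mat_vec_carrier[OF F u])
  have fn: "l2norm f \<le> l2norm u"
    unfolding f_def using op_boundD[OF op_bound_fourier, of u N] u by simp
  have diff: "l2norm (a - b) \<le> l2norm a + l2norm b" if "a \<in> carrier_vec N" "b \<in> carrier_vec N" for a b
  proof -
    have "a - b = a + (- 1) \<cdot>\<^sub>v b" using that by (intro eq_vecI) auto
    then show ?thesis using l2norm_add[of a "(- 1) \<cdot>\<^sub>v b"] that by (simp add: l2norm_smult)
  qed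
  \<comment> \<open>Frequency: \<open>F B\<^sup>m = (B\<^sup>m)\<^sup>T F\<close> turns the operator \<open>B\<^sup>m Q\<close> of the hypothesis into \<open>Q F B\<^sup>m\<close>,
    and \<open>B\<^sup>m u\<close> is close to \<open>z\<^sup>m u\<close>.\<close>
  have freq: "cmod z ^ m * l2norm (?Q *\<^sub>v f) \<le> \<epsilon> * l2norm u + ?v"
  proof -
    have QF: "?Q * ?F \<in> carrier_mat N N" by (rule mult_carrier_mat[OF ind F])
    have bQF: "op_bound (?Q * ?F) (1 * 1)"
      by (rule op_bound_mult[OF op_bound_indicator op_bound_fourier _ ind F]) simp
    have "z ^ m \<cdot>\<^sub>v (?Q *\<^sub>v f) = (?Q * ?F) *\<^sub>v (z ^ m \<cdot>\<^sub>v u)"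
      unfolding f_def mult_mat_vec[OF QF u] assoc_mult_mat_vec[OF ind F u] ..
    also have "\<dots> = (?Q * ?F) *\<^sub>v (?W *\<^sub>v u) - (?Q * ?F) *\<^sub>v r"
      unfolding zu by (rule mult_minus_distrib_mat_vec[OF QF Wu rc])
    also have "(?Q * ?F) *\<^sub>v (?W *\<^sub>v u) = transpose_mat (?W * ?Q) *\<^sub>v f"
    proof -
      have "(?Q * ?F) *\<^sub>v (?W *\<^sub>v u) = (?Q * ?F * ?W) *\<^sub>v u"
        by (rule assoc_mult_mat_vec[OF QF W u, symmetric])
      also have "?Q * ?F * ?W = ?Q * (transpose_mat ?W * ?F)"
        unfolding assoc_mult_mat[OF ind F W] transpose_pow_intertwine[OF B(1) F FB] ..
      also have "\<dots> = transpose_mat (?W * ?Q) * ?F"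
        unfolding transpose_mult[OF W ind] indicator_op_transpose
        by (rule assoc_mult_mat[symmetric, OF ind transpose_carrier_mat[THEN iffD2, OF W] F])
      also have "\<dots> *\<^sub>v u = transpose_mat (?W * ?Q) *\<^sub>v f"
        unfolding f_def by (rule assoc_mult_mat_vec[OF transpose_carrier_mat[THEN iffD2, OF WQ] F u])
      finally show ?thesis .
    qed
    finally have "cmod z ^ m * l2norm (?Q *\<^sub>v f)
        = l2norm (transpose_mat (?W * ?Q) *\<^sub>v f - (?Q * ?F) *\<^sub>v r)"
      using l2norm_smult[of "z ^ m" "?Q *\<^sub>v f"] by (simp add: norm_power)
    also have "\<dots> \<le> l2norm (transpose_mat (?W * ?Q) *\<^sub>v f) + l2norm ((?Q * ?F) *\<^sub>v r)"
      by (rule diff[OF mult_mat_vec_carrier[OF transpose_carrier_mat[THEN iffD2, OF WQ] f]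
            mult_mat_vec_carrier[OF QF rc]])
    also have "l2norm (transpose_mat (?W * ?Q) *\<^sub>v f) \<le> \<epsilon> * l2norm f"
      by (rule op_boundD[OF op_bound_transpose[OF loc]]) (use W f in auto)
    also have "\<epsilon> * l2norm f \<le> \<epsilon> * l2norm u" by (rule mult_left_mono[OF fn loc(2)])
    also have "l2norm ((?Q * ?F) *\<^sub>v r) \<le> 1 * 1 * l2norm r"
      by (rule op_boundD[OF bQF]) (use rc in auto)
    finally show ?thesis using r by simp
  qed
  \<comment> \<open>Position: only the part of \<open>u\<close> on \<open>X\<close> contributes to \<open>B\<^sup>m u\<close>.\<close>
  have pos: "cmod z ^ m * l2norm u \<le> l2norm (?P *\<^sub>v u) + \<epsilon> * l2norm u + ?v"
  proof -
    have Pu: "?P *\<^sub>v u \<in> carrier_vec N" and Qu: "?Q *\<^sub>v u \<in> carrier_vec N"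
      by (rule mult_mat_vec_carrier[OF ind u])+
    have "cmod z ^ m * l2norm u = l2norm (?W *\<^sub>v u - r)"
      using l2norm_smult[of "z ^ m" u] by (simp add: norm_power zu)
    also have "\<dots> \<le> l2norm (?W *\<^sub>v u) + l2norm r" by (rule diff[OF Wu rc])
    also have "l2norm (?W *\<^sub>v u) \<le> l2norm (?P *\<^sub>v u) + \<epsilon> * l2norm u"
    proof -
      have "?W *\<^sub>v u = ?W *\<^sub>v (?P *\<^sub>v u + ?Q *\<^sub>v u)" by (simp only: indicator_op_split[OF u])
      also have "\<dots> = ?W *\<^sub>v (?P *\<^sub>v u) + (?W * ?Q) *\<^sub>v u"
        unfolding mult_add_distrib_mat_vec[OF W Pu Qu] assoc_mult_mat_vec[OF W ind u] ..
      finally have "l2norm (?W *\<^sub>v u) \<le> l2norm (?W *\<^sub>v (?P *\<^sub>v u)) + l2norm ((?W * ?Q) *\<^sub>v u)"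
        using W by (simp add: l2norm_add)
      moreover have "l2norm (?W *\<^sub>v (?P *\<^sub>v u)) \<le> 1 * l2norm (?P *\<^sub>v u)"
        by (rule op_boundD[OF op_bound_pow[OF B]]) (use W Pu in auto)
      moreover have "l2norm ((?W * ?Q) *\<^sub>v u) \<le> \<epsilon> * l2norm u"
        by (rule op_boundD[OF loc(1)]) (use u in auto)
      ultimately show ?thesis by linarith
    qed
    finally show ?thesis using r by simp
  qed
  \<comment> \<open>Uncertainty: a vector with frequencies in \<open>X\<close> has little mass on \<open>X\<close>.\<close>
  have fupu: "l2norm (?P *\<^sub>v u) \<le> \<kappa> * l2norm u + l2norm (?Q *\<^sub>v f)"
  proof -
    have Pf: "?P *\<^sub>v f \<in> carrier_vec N" and Qf: "?Q *\<^sub>v f \<in> carrier_vec N"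
      by (rule mult_mat_vec_carrier[OF ind f])+
    have PG: "?P * ?G \<in> carrier_mat N N" by (rule mult_carrier_mat[OF ind G])
    have Gf: "?G *\<^sub>v f = u"
      unfolding f_def assoc_mult_mat_vec[OF G F u, symmetric] cnj_fourier_mult_fourier[OF N] using u
          by simp
    have "?P *\<^sub>v u = (?P * ?G) *\<^sub>v f"
      unfolding assoc_mult_mat_vec[OF ind G f] Gf ..
    also have "\<dots> = (?P * ?G) *\<^sub>v (?P *\<^sub>v f + ?Q *\<^sub>v f)" by (simp only: indicator_op_split[OF f])
    also have "\<dots> = (?P * ?G * ?P) *\<^sub>v f + (?P * ?G) *\<^sub>v (?Q *\<^sub>v f)"
      unfolding mult_add_distrib_mat_vec[OF PG Pf Qf] assoc_mult_mat_vec[OF PG ind f] ..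
    finally have "l2norm (?P *\<^sub>v u) \<le> l2norm ((?P * ?G * ?P) *\<^sub>v f) + l2norm ((?P * ?G) *\<^sub>v (?Q *\<^sub>v f))"
      by (simp add: l2norm_add)
    moreover have "l2norm ((?P * ?G) *\<^sub>v (?Q *\<^sub>v f)) \<le> 1 * 1 * l2norm (?Q *\<^sub>v f)"
      by (rule op_boundD[OF op_bound_mult[OF op_bound_indicator op_bound_map_cnj[OF op_bound_fourier] _ ind G]])
        (use Qf in auto)
    moreover have "l2norm ((?P * ?G * ?P) *\<^sub>v f) \<le> \<kappa> * l2norm u"
    proof -
      have "?P * ?G * ?P = map_mat cnj (?P * ?F * ?P)"
      proof (rule eq_matI)
        fix i j assume "i < dim_row (map_mat cnj (?P * ?F * ?P))" "j < dim_col (map_mat cnj (?P * ?F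
            * ?P))"
        then have ij: "i < N" "j < N" by auto
        then have "map_mat cnj (?P * ?F * ?P) $$ (i, j) = cnj ((?P * ?F * ?P) $$ (i, j))"
          by (intro index_map_mat) auto
        then show "(?P * ?G * ?P) $$ (i, j) = map_mat cnj (?P * ?F * ?P) $$ (i, j)"
          using ij unfolding indicator_sandwich_index[OF G ij] indicator_sandwich_index[OF F ij]
          by (simp add: indicator_def)
      qed auto
      then have "op_bound (?P * ?G * ?P) \<kappa>" using op_bound_map_cnj[OF fup] by simp
      then have *: "l2norm ((?P * ?G * ?P) *\<^sub>v f) \<le> \<kappa> * l2norm f"
        by (rule op_boundD) (use f in auto)
      have "l2norm u \<le> 1 * l2norm f"
        using op_boundD[OF op_bound_map_cnj[OF op_bound_fourier], of f N] f Gf by simp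
      then have "l2norm f = l2norm u" using fn by simp
      then show ?thesis using * by simp
    qed
    ultimately show ?thesis by linarith
  qed
  \<comment> \<open>The frequency estimate carries its own factor \<open>a\<close>, hence the square in the conclusion.\<close>
  define a where "a = cmod z ^ m"
  have a: "0 \<le> a" "a \<le> 1" unfolding a_def using z by (simp_all add: power_le_one)
  have "a * l2norm u \<le> \<kappa> * l2norm u + l2norm (?Q *\<^sub>v f) + \<epsilon> * l2norm u + ?v"
    using pos fupu unfolding a_def by linarith
  then have "a * (a * l2norm u) \<le> a * (\<kappa> * l2norm u + l2norm (?Q *\<^sub>v f) + \<epsilon> * l2norm u + ?v)"
    using a by (intro mult_left_mono)
  also have "\<dots> = a * \<kappa> * l2norm u + a * l2norm (?Q *\<^sub>v f) + a * (\<epsilon> * l2norm u + ?v)"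
    by (simp add: algebra_simps)
  also have "a * (\<epsilon> * l2norm u + ?v) \<le> 1 * (\<epsilon> * l2norm u + ?v)"
    using a loc(2) by (intro mult_right_mono) auto
  also have "a * l2norm (?Q *\<^sub>v f) \<le> \<epsilon> * l2norm u + ?v" using freq unfolding a_def .
  finally show ?thesis unfolding a_def by (simp add: algebra_simps power2_eq_square)
qed

text \<open>
  In finite dimension an injective operator is invertible, and the lower bound is the bound on the
  inverse.
\<close>

lemma invertible_of_lower_bound:
  assumes T: "T \<in> carrier_mat N N" and "0 \<le> c"
    and lower: "\<And>u. u \<in> carrier_vec N \<Longrightarrow> l2norm u \<le> c * l2norm (T *\<^sub>v u)"
  shows "invertible_mat T \<and> (\<exists>R \<in> carrier_mat N N. inverts_mat T R \<and> inverts_mat R T \<and> opnorm R \<le> c)"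
proof -
  have "det T \<noteq> 0"
  proof
    assume "det T = 0"
    then obtain v where v: "v \<in> carrier_vec N" "v \<noteq> 0\<^sub>v N" "T *\<^sub>v v = 0\<^sub>v N"
      using det_0_iff_vec_prod_zero_field[OF T] by auto
    then have "l2norm v \<le> 0" using lower[of v] by simp
    then have "l2norm v = 0" using l2norm_nonneg[of v] by linarith
    then show False using v l2norm_eq_0_iff by blast
  qed
  from det_non_zero_imp_unit[OF T this, of "()"]
  obtain R where R: "R \<in> carrier_mat N N" "R * T = 1\<^sub>m N" "T * R = 1\<^sub>m N"
    by (auto simp: Units_def ring_mat_simps)
  have inv: "inverts_mat T R" "inverts_mat R T"
    using R T by (auto simp: inverts_mat_def)
  have "op_bound R c" unfolding op_bound_def
  proof
    fix v :: "complex vec" assume "v \<in> carrier_vec (dim_col R)"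
    then have v: "v \<in> carrier_vec N" using R by auto
    have "l2norm (R *\<^sub>v v) \<le> c * l2norm (T *\<^sub>v (R *\<^sub>v v))"
      by (rule lower[OF mult_mat_vec_carrier[OF R(1) v]])
    also have "T *\<^sub>v (R *\<^sub>v v) = v"
      using assoc_mult_mat_vec[OF T R(1) v] v by (simp add: R(3))
    finally show "l2norm (R *\<^sub>v v) \<le> c * l2norm v" .
  qed
  then have "opnorm R \<le> c" by (rule opnorm_le) fact
  moreover have "invertible_mat T"
    using inv T unfolding invertible_mat_def by auto
  ultimately show ?thesis using R(1) inv by blast
qed

section \<open>Choice of scales and the resolvent bound\<close>

lemma eventually_linear_le_power:
  fixes b c :: real
  assumes "1 < b"
  obtains k0 :: nat where "\<And>k. k0 \<le> k \<Longrightarrow> c * real k \<le> b ^ k"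
proof -
  have "(\<lambda>n. c * (of_nat n * (1 / b) ^ n)) \<longlonglongrightarrow> c * 0"
    using assms by (intro tendsto_mult_left powser_times_n_limit_0) auto
  then have "eventually (\<lambda>n. c * (of_nat n * (1 / b) ^ n) < 1) sequentially"
    by (intro order_tendstoD) auto
  then obtain k0 where k0: "\<And>k. k0 \<le> k \<Longrightarrow> c * (real k * (1 / b) ^ k) < 1"
    by (auto simp: eventually_sequentially)
  show ?thesis
  proof
    fix k assume "k0 \<le> k"
    then show "c * real k \<le> b ^ k"
      using k0[of k] assms by (simp add: power_divide pos_divide_less_eq)
  qed
qed

text \<open>
  Here \<open>(9 * b powr s)\<^sup>2\<close> is the loss from thickening the Cantor sets by the scale \<open>b powr s\<close>.
\<close>

lemma uncertainty_beats_neighbourhood: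
  fixes b s k \<nu> \<beta> \<sigma> :: real
  assumes "1 < b" "0 \<le> k" "s \<le> \<sigma> * k" "2 * \<sigma> \<le> (\<beta> - \<nu>) / 2" "324 \<le> b powr ((\<beta> - \<nu>) / 2 * k)"
  shows "4 * ((9 * b powr s)\<^sup>2 * b powr (- \<beta> * k)) \<le> b powr (- \<nu> * k)"
proof -
  have sq: "(9 * b powr s)\<^sup>2 = 81 * b powr (2 * s)"
    by (simp add: power2_eq_square flip: powr_add)
  have "2 * \<sigma> * k \<le> (\<beta> - \<nu>) / 2 * k" using assms by (intro mult_right_mono) auto
  then have "2 * s + - \<beta> * k \<le> - ((\<beta> - \<nu>) / 2 * k) + - \<nu> * k"
    using assms(3) by (simp add: field_simps)
  then have "b powr (2 * s + - \<beta> * k) \<le> b powr (- ((\<beta> - \<nu>) / 2 * k) + - \<nu> * k)"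
    using assms(1) by (intro powr_mono) auto
  then have "b powr (2 * s) * b powr (- \<beta> * k) \<le> b powr (- ((\<beta> - \<nu>) / 2 * k)) * b powr (- \<nu> * k)"
    unfolding powr_add .
  then have "4 * ((9 * b powr s)\<^sup>2 * b powr (- \<beta> * k))
      \<le> 324 * b powr (- ((\<beta> - \<nu>) / 2 * k)) * b powr (- \<nu> * k)"
    unfolding sq by simp
  also have "\<dots> \<le> b powr ((\<beta> - \<nu>) / 2 * k) * b powr (- ((\<beta> - \<nu>) / 2 * k)) * b powr (- \<nu> * k)"
    using assms(5) by (intro mult_right_mono) auto
  also have "b powr ((\<beta> - \<nu>) / 2 * k) * b powr (- ((\<beta> - \<nu>) / 2 * k)) = 1"
    using assms(1) by (simp flip: powr_add)
  finally show ?thesis by simp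
qed

text \<open>
  Up to the factor \<open>8\<close>, the left side bounds the leakage of the iterated map outside the neighbourhoods of the Cantor sets
  at scale \<open>b powr s\<close>; the right
  side is a lower bound for \<open>\<bar>z\<bar> ^ (2 * k)\<close>.
\<close>

lemma decay_beats_resolvent_growth:
  fixes b s k \<nu> \<sigma> K :: real
  assumes "1 < b" "0 \<le> k" "0 \<le> K" "\<sigma> * k - 1 \<le> s" "2 + 2 * \<nu> \<le> \<sigma> * real L"
    and "8 * K * b powr real L * k \<le> b powr k"
  shows "8 * (k * (b powr k * (K / (b powr s) ^ L))) \<le> (b powr (- \<nu> * k))\<^sup>2"
proof -
  have "(\<sigma> * k - 1) * real L \<le> s * real L" using assms(4) by (intro mult_right_mono) auto
  moreover have "(2 + 2 * \<nu>) * k \<le> \<sigma> * real L * k"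
    using assms(2,5) by (intro mult_right_mono) auto
  ultimately have exponent: "k - s * real L \<le> real L - k - 2 * \<nu> * k"
    by (simp add: algebra_simps)
  have "b powr k / (b powr s) ^ L = b powr (k - s * real L)"
    using assms(1) by (simp add: powr_diff powr_powr flip: powr_realpow)
  also have "\<dots> \<le> b powr (real L - k - 2 * \<nu> * k)"
    using exponent assms(1) by (intro powr_mono) auto
  also have "\<dots> = b powr real L * (b powr (- k) * b powr (- 2 * \<nu> * k))"
    unfolding powr_add[symmetric] by (simp add: algebra_simps)
  finally have "8 * k * K * (b powr k / (b powr s) ^ L)
      \<le> 8 * k * K * (b powr real L * (b powr (- k) * b powr (- 2 * \<nu> * k)))"
    using assms(2,3) by (intro mult_left_mono) auto
  also have "\<dots> = 8 * K * b powr real L * k * (b powr (- k) * b powr (- 2 * \<nu> * k))"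
    by (simp add: mult_ac)
  also have "\<dots> \<le> b powr k * (b powr (- k) * b powr (- 2 * \<nu> * k))"
    using assms(6) by (intro mult_right_mono) auto
  also have "\<dots> = (b powr (- \<nu> * k))\<^sup>2"
    unfolding power2_eq_square powr_add[symmetric] using assms(1) by (simp add: algebra_simps)
  finally show ?thesis by (simp add: mult_ac)
qed

text \<open>
  Stopping \<open>s\<close> steps early leaves room for the linear factor \<open>k - s\<close>, which is why the final estimate has
  no logarithmic loss in \<open>N\<close>.
\<close>

lemma iteration_count_absorbed:
  fixes b s k \<nu> \<sigma> :: real
  assumes "1 < b" "0 \<le> \<nu>" "0 \<le> s" "\<sigma> * k - 1 \<le> s" "k \<le> b powr (2 * \<nu> * \<sigma> * k)"
  shows "k - s \<le> b powr (2 * \<nu>) * b powr (2 * \<nu> * k) * (b powr (- \<nu> * (k - s)))\<^sup>2"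
proof -
  have "2 * \<nu> * (\<sigma> * k) \<le> 2 * \<nu> * (1 + s)" using assms(2,4) by (intro mult_left_mono) auto
  then have "2 * \<nu> * \<sigma> * k \<le> 2 * \<nu> + 2 * \<nu> * k + 2 * (- \<nu> * (k - s))"
    by (simp add: algebra_simps)
  then have "b powr (2 * \<nu> * \<sigma> * k) \<le> b powr (2 * \<nu> + 2 * \<nu> * k + 2 * (- \<nu> * (k - s)))"
    using assms(1) by (intro powr_mono) auto
  also have "\<dots> = b powr (2 * \<nu>) * b powr (2 * \<nu> * k) * (b powr (- \<nu> * (k - s)))\<^sup>2"
    unfolding power2_eq_square powr_add[symmetric] by (simp add: algebra_simps)
  finally show ?thesis using assms(3,5) by linarith
qed

theorem proposition4p2:
  fixes M :: nat and A :: "nat set" and \<chi> :: "real \<Rightarrow> real" and \<nu> :: real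
  assumes "A \<subseteq> {..<M}" and "1 < card A" and "card A < M"
    and "\<chi> \<in> cutoffs"
    and "0 < \<nu>" and "ereal \<nu> < fup_exponent M A"
  shows "\<exists>(N0::nat) (C::real). \<forall>(k::nat) (N::nat) (z::complex).
    k \<ge> 1 \<and> N = M ^ k \<and> N \<ge> N0 \<and> real M powr (- \<nu>) \<le> cmod z \<and> cmod z \<le> 1 \<longrightarrow>
      (let T = baker_map M A \<chi> N - z \<cdot>\<^sub>m 1\<^sub>m N in
        invertible_mat T \<and>
        (\<exists>R \<in> carrier_mat N N. inverts_mat T R \<and> inverts_mat R T \<and>
          opnorm R \<le> C * real N powr (2 * \<nu>)))"
proof -
  define b where "b = real M"
  have M: "2 \<le> M" using assms(2,3) by simp
  then have b: "1 < b" "0 < b" by (simp_all add: b_def)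
  have "A \<noteq> {}" using assms(2) by auto
  obtain \<beta> k1 where \<beta>: "\<nu> < \<beta>"
    and k1: "\<And>k. k1 \<le> k \<Longrightarrow> 1 \<le> k \<Longrightarrow> fup_norm M A k \<le> real M powr (- \<beta> * real k)"
    using fup_norm_decay[OF assms(6)] M by (metis less_le_trans one_less_numeral_iff semiring_norm(76))
  \<comment> \<open>The sets are thickened by about \<open>M powr (\<sigma> * k)\<close>. This costs \<open>M powr (2 * \<sigma> * k)\<close> in the
    uncertainty bound, at most half of the available gain \<open>M powr ((\<beta> - \<nu>) * k)\<close>.\<close>
  define \<sigma> where "\<sigma> = min (1 / 2) ((\<beta> - \<nu>) / 4)"
  have \<sigma>: "0 < \<sigma>" "\<sigma> \<le> 1" "2 * \<sigma> \<le> (\<beta> - \<nu>) / 2" using \<beta> by (simp_all add: \<sigma>_def min_def)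
  \<comment> \<open>The order of decay must beat the factor \<open>N\<close> from the entrywise norm estimate, the number \<open>k\<close> of
    iterations (for which another \<open>N\<close> is spent) and the loss \<open>M powr (2 * \<nu> * k)\<close>.\<close>
  obtain L :: nat where "(2 + 2 * \<nu>) / \<sigma> \<le> real L" using real_arch_simple by blast
  then have L: "2 + 2 * \<nu> \<le> \<sigma> * real L" using \<sigma> by (simp add: pos_divide_le_eq mult.commute)
  obtain K where K: "0 \<le> K"
    "\<And>n x a q. 0 < n \<Longrightarrow> x < M * n \<Longrightarrow> a < M \<Longrightarrow> q < n \<Longrightarrow> a \<notin> A \<Longrightarrow>
        baker_map M A \<chi> (M * n) $$ (x, a * n + q) = 0"
    "\<And>n x a q. 0 < n \<Longrightarrow> x < M * n \<Longrightarrow> a < M \<Longrightarrow> q < n \<Longrightarrow>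
        cmod (baker_map M A \<chi> (M * n) $$ (x, a * n + q)) * \<bar>real x / real M - real q\<bar> ^ L \<le> K"
    using baker_map_kernel_decay[OF assms(4,1), of L] by blast
  obtain k2 where k2: "\<And>k. k2 \<le> k \<Longrightarrow> (8 * K * b powr real L) * real k \<le> b ^ k"
    using eventually_linear_le_power[OF b(1)] by blast
  have "1 < b powr ((\<beta> - \<nu>) / 2)" "1 < b powr (2 * \<nu> * \<sigma>)"
    using b \<beta> \<sigma> assms(5) by simp_all
  then obtain k3 k4 where k3: "\<And>k. k3 \<le> k \<Longrightarrow> 324 * real k \<le> (b powr ((\<beta> - \<nu>) / 2)) ^ k"
    and k4: "\<And>k. k4 \<le> k \<Longrightarrow> 1 * real k \<le> (b powr (2 * \<nu> * \<sigma>)) ^ k"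
    using eventually_linear_le_power by metis
  define k0 where "k0 = max (max k1 k2) (max k3 k4)"
  \<comment> \<open>the extra \<open>b powr (2 * \<nu>)\<close> pays for rounding \<open>\<sigma> * k\<close> to an integer\<close>
  define C where "C = 4 * b powr (2 * \<nu>)"
  have main: "l2norm u \<le> C * real (M ^ k) powr (2 * \<nu>)
      * l2norm (baker_map M A \<chi> (M ^ k) *\<^sub>v u - z \<cdot>\<^sub>v u)"
    if k: "1 \<le> k" "k0 \<le> k" and z: "b powr (- \<nu>) \<le> cmod z" "cmod z \<le> 1" and u: "u \<in> carrier_vec (M ^ k)"
    for k z u
  proof -
    define s where "s = nat \<lfloor>\<sigma> * real k\<rfloor>"
    define m where "m = k - s"
    have s: "real s \<le> \<sigma> * real k" "\<sigma> * real k - 1 \<le> real s"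
    proof -
      have "real s = of_int \<lfloor>\<sigma> * real k\<rfloor>" using \<sigma> by (simp add: s_def)
      then show "real s \<le> \<sigma> * real k" "\<sigma> * real k - 1 \<le> real s" by linarith+
    qed
    have "\<sigma> * real k \<le> 1 * real k" using \<sigma> by (intro mult_right_mono) auto
    then have "s \<le> k" using s(1) by simp
    then have m: "m \<le> k" "k - m = s" "real m = real k - real s" by (auto simp: m_def)
    obtain k' where k': "k = Suc k'" using k(1) by (cases k) auto
    define R where "R = real (M ^ s)"
    have R: "0 < R" "R = b powr real s" using M b by (simp_all add: R_def b_def powr_realpow)
    define X where "X = cantor_nbhd M A k R m"
    define S where "S = {- 4 * int (M ^ s)..4 * int (M ^ s)}"
    define \<epsilon> where "\<epsilon> = real m * (real (M ^ k) * (K / R ^ L))"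
    define \<kappa> where "\<kappa> = (real (card S))\<^sup>2 * fup_norm M A k"
    define a where "a = cmod z ^ m"
    define v where "v = baker_map M A \<chi> (M ^ k) *\<^sub>v u - z \<cdot>\<^sub>v u"
    have N: "0 < M ^ k" using M by simp
    have \<epsilon>0: "0 \<le> \<epsilon>" using K(1) R by (simp add: \<epsilon>_def)
    have loc: "op_bound (baker_map M A \<chi> (M ^ k) ^\<^sub>m m * indicator_op (M ^ k) (- X)) \<epsilon>"
      unfolding X_def \<epsilon>_def k'
      by (rule baker_map_localized[OF assms(1,4) M R(1) K(1)])
        (use K M m(1) k' in auto)
    have fup: "op_bound (indicator_op (M ^ k) X * fourier (M ^ k) * indicator_op (M ^ k) X) \<kappa>"
      unfolding \<kappa>_def
    proof (rule op_bound_fourier_translates_both[OF N _ _ _ _ fup_norm_bound])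
      show "cantor M A k \<subseteq> {..<M ^ k}" using cantor_less[OF assms(1)] by auto
      show "0 \<le> fup_norm M A k" unfolding fup_norm_def Let_def by (rule opnorm_nonneg)
      show "\<exists>c\<in>cantor M A k. \<exists>t\<in>S. int x = int c + t" if "x \<in> X" for x
        using cantor_nbhd_subset_translates[OF assms(1) \<open>A \<noteq> {}\<close> m(1) _ that[unfolded X_def]]
        unfolding S_def m(2) by (simp add: R_def)
    qed (simp add: S_def)
    have step: "a\<^sup>2 * l2norm u \<le> (a * \<kappa> + 2 * \<epsilon>) * l2norm u + 2 * real m * l2norm v"
      unfolding a_def v_def
      using op_bound_baker_map[OF assms(4) _ assms(1), of "M ^ k'"]
        fourier_mult_baker_map[OF _ assms(1), of "M ^ k'" \<chi>] M
      by (intro uncertainty_resolvent_bound[OF N baker_map_carrier _ _ loc \<epsilon>0 fup z(2) u]) (simp_all add: k')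
    have a: "b powr (- \<nu> * real m) \<le> a"
    proof -
      have "(b powr (- \<nu>)) ^ m \<le> a" unfolding a_def using z by (intro power_mono) auto
      then show ?thesis using b by (simp add: powr_powr flip: powr_realpow)
    qed
    have ak: "b powr (- \<nu> * real k) \<le> a"
    proof -
      have "b powr (- \<nu> * real k) \<le> b powr (- \<nu> * real m)" using b m(1) assms(5)
          by (intro powr_mono) auto
      then show ?thesis using a by linarith
    qed
    have a0: "0 < a" by (rule less_le_trans[OF _ a]) (use b in simp)
    have kapp: "4 * \<kappa> \<le> a"
    proof -
      have "1 \<le> M ^ s" using M by simp
      then have "card S \<le> 9 * M ^ s" unfolding S_def card_atLeastAtMost_int by linarith
      then have "real (card S) \<le> real (9 * M ^ s)" by (simp only: of_nat_le_iff)
      then have "real (card S) \<le> 9 * b powr real s" by (simp add: R_def flip: R(2))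
      then have "\<kappa> \<le> (9 * b powr real s)\<^sup>2 * b powr (- \<beta> * real k)"
        unfolding \<kappa>_def b_def using k1[of k] k k0_def
        by (intro mult_mono power_mono) (auto simp: fup_norm_def Let_def opnorm_nonneg)
      moreover have "324 \<le> b powr ((\<beta> - \<nu>) / 2 * real k)"
        using k3[of k] k k0_def b by (simp add: powr_powr flip: powr_realpow)
      ultimately show ?thesis
        using uncertainty_beats_neighbourhood[OF b(1) _ s(1) \<sigma>(3)] ak by fastforce
    qed
    have eps: "8 * \<epsilon> \<le> a\<^sup>2"
    proof -
      have "\<epsilon> \<le> real k * (b powr real k * (K / (b powr real s) ^ L))"
        unfolding \<epsilon>_def using K(1) R b m(1) by (intro mult_mono) (auto simp: b_def powr_realpow)
      moreover have "(b powr (- \<nu> * real k))\<^sup>2 \<le> a\<^sup>2" using ak by (intro power_mono) auto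
      moreover have "8 * K * b powr real L * real k \<le> b powr real k"
        using k2[of k] k k0_def b by (simp add: powr_realpow)
      ultimately show ?thesis
        using decay_beats_resolvent_growth[OF b(1) _ K(1) s(2) L] by fastforce
    qed
    have "a * (4 * \<kappa>) \<le> a * a" using kapp a0 by (intro mult_left_mono) auto
    then have "a * \<kappa> + 2 * \<epsilon> \<le> a\<^sup>2 / 2" using eps by (simp add: power2_eq_square)
    then have "(a * \<kappa> + 2 * \<epsilon>) * l2norm u \<le> a\<^sup>2 / 2 * l2norm u" by (intro mult_right_mono) auto
    then have 1: "a\<^sup>2 * l2norm u \<le> 4 * real m * l2norm v" using step by simp
    have 2: "real m \<le> b powr (2 * \<nu>) * b powr (2 * \<nu> * real k) * a\<^sup>2"
    proof -
      have "real k \<le> b powr (2 * \<nu> * \<sigma> * real k)"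
        using k4[of k] k k0_def b by (simp add: powr_powr flip: powr_realpow)
      then have "real m \<le> b powr (2 * \<nu>) * b powr (2 * \<nu> * real k) * (b powr (- \<nu> * real m))\<^sup>2"
        unfolding m(3) using assms(5) by (intro iteration_count_absorbed[OF b(1) _ _ s(2)]) auto
      also have "\<dots> \<le> b powr (2 * \<nu>) * b powr (2 * \<nu> * real k) * a\<^sup>2"
        using a by (intro mult_left_mono power_mono) auto
      finally show ?thesis .
    qed
    have "a\<^sup>2 * l2norm u \<le> 4 * (b powr (2 * \<nu>) * b powr (2 * \<nu> * real k) * a\<^sup>2) * l2norm v"
      using 1 2 by (meson l2norm_nonneg mult_left_mono mult_right_mono order_trans zero_le_numeral)
    also have "\<dots> = a\<^sup>2 * (C * b powr (2 * \<nu> * real k) * l2norm v)" by (simp add: C_def)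
    finally have "l2norm u \<le> C * b powr (2 * \<nu> * real k) * l2norm v" using a0 by simp
    moreover have "real (M ^ k) powr (2 * \<nu>) = b powr (2 * \<nu> * real k)"
      using b by (simp add: b_def powr_powr mult.commute flip: powr_realpow)
    ultimately show ?thesis by (simp add: v_def)
  qed
  show ?thesis
  proof (intro exI[of _ "M ^ k0"] exI[of _ C] allI impI)
    fix k N :: nat and z :: complex
    assume h: "k \<ge> 1 \<and> N = M ^ k \<and> N \<ge> M ^ k0 \<and> real M powr (- \<nu>) \<le> cmod z \<and> cmod z \<le> 1"
    then have k: "k0 \<le> k" using M by (auto simp: power_increasing_iff)
    define T where "T = baker_map M A \<chi> N - z \<cdot>\<^sub>m 1\<^sub>m N"
    have T: "T \<in> carrier_mat N N" unfolding T_def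
        by (intro minus_carrier_mat smult_carrier_mat one_carrier_mat)
    have "invertible_mat T \<and> (\<exists>R \<in> carrier_mat N N. inverts_mat T R \<and> inverts_mat R T \<and>
          opnorm R \<le> C * real N powr (2 * \<nu>))"
    proof (rule invertible_of_lower_bound[OF T])
      show "0 \<le> C * real N powr (2 * \<nu>)" by (simp add: C_def)
      fix u :: "complex vec" assume u: "u \<in> carrier_vec N"
      have "T *\<^sub>v u = baker_map M A \<chi> N *\<^sub>v u - (z \<cdot>\<^sub>m 1\<^sub>m N) *\<^sub>v u"
        unfolding T_def by (rule minus_mult_distrib_mat_vec[OF baker_map_carrier _ u]) simp
      also have "(z \<cdot>\<^sub>m 1\<^sub>m N) *\<^sub>v u = z \<cdot>\<^sub>v u" using u by (intro eq_vecI) auto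
      finally show "l2norm u \<le> C * real N powr (2 * \<nu>) * l2norm (T *\<^sub>v u)"
        using main[of k z u] h k u by (simp add: b_def)
    qed
    then show "let T = baker_map M A \<chi> N - z \<cdot>\<^sub>m 1\<^sub>m N in
        invertible_mat T \<and>
        (\<exists>R \<in> carrier_mat N N. inverts_mat T R \<and> inverts_mat R T \<and>
          opnorm R \<le> C * real N powr (2 * \<nu>))"
      unfolding Let_def T_def .
  qed
qed

end
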